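(* Let $k\ge2$, let $\mu$ be a nonnegative Borel measure on $(\mathbb{R}^d)^k$, and let $T_\mu(f_1,\dots,f_k)(x)=\int\cdots\int f_1(x-u^1)\cdots f_k(x-u^k)\,d\mu(u^1,\dots,u^k)$. For $1\le i\le k$, define the $i$-th multilinear adjoint $T^{*_i}_\mu$ by $$\langle T_\mu(f_1,\dots,f_{i-1},f_i,f_{i+1},\dots,f_k),f_{k+1}\rangle=\langle T^{*_i}_\mu(f_1,\dots,f_{i-1},f_{k+1},f_{i+1},\dots,f_k),f_i\rangle,$$ where $\langle\cdot,\cdot\rangle$ is the $L^2(\mathbb{R}^d)$ inner product. Then: (1) If $|\widehat\mu(-\xi,\xi,0,\dots,0)|\lesssim(1+|\xi|)^{-\gamma}$ for some $\gamma>0$, then for all $\gamma_1,\gamma_2>0$ with $\gamma=\gamma_1+\gamma_2$ and each $i=3,4,\dots,k$, on nonnegative functions, $T^{*_i}_\mu:L^2_{-\frac{\gamma_1}{2}}(\mathbb{R}^d)\times L^2_{-\frac{\gamma_2}{2}}(\mathbb{R}^d)\times L^\infty(\mathbb{R}^d)\times\cdots\times L^\infty(\mathbb{R}^d)\to L^1(\mathbb{R}^d)$. (2) If $|\widehat\mu(0,\xi,0,\dots,0)|\lesssim(1+|\xi|)^{-\gamma}$ for some $\gamma>0$, then for all $\gamma_1,\gamma_2>0$ with $\gamma=\gamma_1+\gamma_2$, on nonnegative functions, $T^{*_1}_\mu:L^2_{-\frac{\gamma_1}{2}}\times L^2_{-\frac{\gamma_2}{2}}\times L^\infty\times\cdots\times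 L^\infty\to L^1(\mathbb{R}^d)$. (3) If $|\widehat\mu(\xi,0,0,\dots,0)|\lesssim(1+|\xi|)^{-\gamma}$ for some $\gamma>0$, then for all $\gamma_1,\gamma_2>0$ with $\gamma=\gamma_1+\gamma_2$, on nonnegative functions, $T^{*_2}_\mu:L^2_{-\frac{\gamma_1}{2}}\times L^2_{-\frac{\gamma_2}{2}}\times L^\infty\times\cdots\times L^\infty\to L^1(\mathbb{R}^d)$.
   Context: $L^p_s(\mathbb{R}^d)$ is the Sobolev space with norm $\|(I-\Delta)^{s/2}g\|_{L^p}$; a mapping $X_1\times\cdots\times X_k\to L^1$ on nonnegative functions means $\|T(f_1,\dots,f_k)\|_{L^1}\lesssim\prod_j\|f_j\|_{X_j}$ for nonnegative $f_j$. *)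

theory Defs
  imports "HOL-Probability.Probability"
begin

text \<open>Points of (R^d)^k are represented as functions u :: nat => 'a, with u j the
  (j+1)-th block (0-based indexing, only j < k matters).  Functions f_1..f_k are
  families f :: nat => 'a => real, with f j standing for f_(j+1).\<close>

definition nonneg_fam :: "nat \<Rightarrow> (nat \<Rightarrow> 'a::euclidean_space \<Rightarrow> real) \<Rightarrow> bool" where
  "nonneg_fam k f \<longleftrightarrow> (\<forall>j<k. f j \<in> borel_measurable lborel \<and> (\<forall>x. 0 \<le> f j x))"

definition T_mu :: "(nat \<Rightarrow> 'a::euclidean_space) measure \<Rightarrow> nat \<Rightarrow> (nat \<Rightarrow> 'a \<Rightarrow> real) \<Rightarrow> 'a \<Rightarrow> ennreal" where
  "T_mu \<mu> k f x = (\<integral>\<^sup>+ u. (\<Prod>j<k. ennreal (f j (x - u j))) \<partial>\<mu>)"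

definition is_adjoint :: "(nat \<Rightarrow> 'a::euclidean_space) measure \<Rightarrow> nat \<Rightarrow> nat
    \<Rightarrow> ((nat \<Rightarrow> 'a \<Rightarrow> real) \<Rightarrow> 'a \<Rightarrow> ennreal) \<Rightarrow> bool" where
  "is_adjoint \<mu> k i S \<longleftrightarrow>
     (\<forall>f. nonneg_fam k f \<longrightarrow> S f \<in> borel_measurable lborel) \<and>
     (\<forall>f g. nonneg_fam k f \<longrightarrow> g \<in> borel_measurable lborel \<longrightarrow> (\<forall>x. 0 \<le> g x) \<longrightarrow>
        (\<integral>\<^sup>+ x. T_mu \<mu> k f x * ennreal (g x) \<partial>lborel)
          = (\<integral>\<^sup>+ y. S (f(i := g)) y * ennreal (f i y) \<partial>lborel))"

definition fourier_meas :: "(nat \<Rightarrow> 'a::euclidean_space) measure \<Rightarrow> nat \<Rightarrow> (nat \<Rightarrow> 'a) \<Rightarrow> complex" where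
  "fourier_meas \<mu> k \<xi> = (\<integral> u. cis (- 2 * pi * (\<Sum>j<k. \<xi> j \<bullet> u j)) \<partial>\<mu>)"

text \<open>Bessel kernel G_s (s > 0) on R^d, d = DIM('a): the kernel of (I - Laplacian)^(-s/2)
  (Stein, Singular Integrals, V.3).\<close>
definition bessel_kernel :: "real \<Rightarrow> 'a::euclidean_space \<Rightarrow> ennreal" where
  "bessel_kernel s x = ennreal (1 / ((4 * pi) powr (s / 2) * Gamma (s / 2))) *
     (\<integral>\<^sup>+ t. indicator {0<..} t *
        ennreal (exp (- pi * (norm x)\<^sup>2 / t) * exp (- t / (4 * pi)) * t powr ((s - real DIM('a)) / 2 - 1))
      \<partial>lborel)"

definition ennsqrt :: "ennreal \<Rightarrow> ennreal" where
  "ennsqrt z = (if z = \<infinity> then \<infinity> else ennreal (sqrt (enn2real z)))"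

text \<open>Norm of a nonnegative function f in L^2_{-s}, s > 0:
  || (I - Laplacian)^(-s/2) f ||_{L^2} = || G_s * f ||_{L^2}.\<close>
definition sobolev_neg_norm :: "real \<Rightarrow> ('a::euclidean_space \<Rightarrow> real) \<Rightarrow> ennreal" where
  "sobolev_neg_norm s f =
     ennsqrt (\<integral>\<^sup>+ x. (\<integral>\<^sup>+ y. bessel_kernel s (x - y) * ennreal (f y) \<partial>lborel)\<^sup>2 \<partial>lborel)"

definition Linf_norm :: "('a::euclidean_space \<Rightarrow> real) \<Rightarrow> ennreal" where
  "Linf_norm f = esssup lborel (\<lambda>x. ennreal (f x))"

definition adjoint_bounded :: "(nat \<Rightarrow> 'a::euclidean_space) measure \<Rightarrow> nat \<Rightarrow> nat \<Rightarrow> real \<Rightarrow> real \<Rightarrow> bool" where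
  "adjoint_bounded \<mu> k i g1 g2 \<longleftrightarrow>
     (\<exists>C::real. \<forall>S. is_adjoint \<mu> k i S \<longrightarrow>
        (\<forall>h. nonneg_fam k h \<longrightarrow>
           sobolev_neg_norm (g1 / 2) (h 0) < \<infinity> \<longrightarrow>
           sobolev_neg_norm (g2 / 2) (h 1) < \<infinity> \<longrightarrow>
           (\<forall>j\<in>{2..<k}. Linf_norm (h j) < \<infinity>) \<longrightarrow>
           (\<integral>\<^sup>+ y. S h y \<partial>lborel)
             \<le> ennreal C * sobolev_neg_norm (g1 / 2) (h 0) * sobolev_neg_norm (g2 / 2) (h 1)
                 * (\<Prod>j\<in>{2..<k}. Linf_norm (h j))))"

end

theory Submission
  imports Defs
begin

text \<open>Testing the adjoint against the constant \<open>1\<close> and bounding the \<open>L\<^sup>\<infinity>\<close> factors leaves the bilinear form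
  \<open>\<integral>\<integral> f(x) g(x - w) d\<nu>(w) dx\<close>, where \<open>\<nu>\<close> is a push-forward of \<open>\<mu>\<close> whose Fourier transform is
  \<open>O((1 + |\<xi>|)\<^sup>-\<^sup>\<gamma>)\<close>. Smoothing \<open>\<nu>\<close> with a Gaussian, the form becomes an absolutely convergent
  frequency integral, which Cauchy-Schwarz bounds by weighted \<open>L\<^sup>2\<close> norms of the transforms of \<open>f\<close>
  and \<open>g\<close>, uniformly in the smoothing. Since the Bessel kernel is a positive superposition of
  Gaussians, Gaussian convolution identities and Tonelli's theorem bound those weighted norms by
  multiples of \<open>\<parallel>G\<^sub>s * f\<parallel>\<^sub>2\<close>. Positivity then allows the smoothing and the
  truncations of \<open>f\<close> and \<open>g\<close> to be removed by Fatou and monotone convergence.\<close>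

section \<open>Gaussians\<close>

text \<open>Lebesgue measure on \<open>'a\<close> is the image of a product of one-dimensional
  Lebesgue measures under the coordinate map, so Fubini for finite products applies. This is the
  Bochner counterpart of \<open>nn_integral_lborel_prod\<close>.\<close>

lemma
  fixes f :: "'a::euclidean_space \<Rightarrow> real \<Rightarrow> 'b::{real_normed_field,banach,second_countable_topology}"
  assumes f: "\<And>b. b \<in> Basis \<Longrightarrow> integrable lborel (f b)"
  shows integrable_lborel_prod: "integrable lborel (\<lambda>x. \<Prod>b\<in>Basis. f b (x \<bullet> b))"
    and integral_lborel_prod:
      "(\<integral>x. (\<Prod>b\<in>Basis. f b (x \<bullet> b)) \<partial>lborel) = (\<Prod>b\<in>Basis. \<integral>x. f b x \<partial>lborel)"
proof -
  interpret product_sigma_finite "\<lambda>_::'a. lborel :: real measure" ..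
  have [measurable]: "f b \<in> borel_measurable borel" if "b \<in> Basis" for b
    using f[OF that] by (simp add: integrable_iff_bounded)
  have sel: "(\<Prod>b\<in>Basis. f b ((\<Sum>c\<in>Basis. u c *\<^sub>R c) \<bullet> b)) = (\<Prod>b\<in>Basis. f b (u b))" for u :: "'a \<Rightarrow> real"
    by (intro prod.cong) auto
  have int: "integrable (\<Pi>\<^sub>M b\<in>Basis. lborel) (\<lambda>u. \<Prod>b\<in>Basis. f b (u b))"
    using f by (intro product_integrable_prod) auto
  show "integrable lborel (\<lambda>x. \<Prod>b\<in>Basis. f b (x \<bullet> b))"
    using int by (subst lborel_eq) (simp add: integrable_distr_eq sel)
  show "(\<integral>x. (\<Prod>b\<in>Basis. f b (x \<bullet> b)) \<partial>lborel) = (\<Prod>b\<in>Basis. \<integral>x. f b x \<partial>lborel)"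
    using f by (subst lborel_eq) (simp add: integral_distr sel product_integral_prod)
qed

text \<open>For \<open>t > 0\<close> this is the centred normal density with variance
  \<open>t / (2 * pi)\<close> in each coordinate. In this scaling its Fourier transform is
  \<open>exp (- pi * t * (norm \<xi>)\<^sup>2)\<close>, and widths add under convolution.\<close>

definition gauss :: "real \<Rightarrow> 'a::euclidean_space \<Rightarrow> real" where
  "gauss t x = exp (- pi * (norm x)\<^sup>2 / t) * t powr (- real DIM('a) / 2)"

lemma gauss_measurable [measurable]:
  "(\<lambda>(t, x::'a::euclidean_space). gauss t x) \<in> borel_measurable (borel \<Otimes>\<^sub>M borel)"
  unfolding gauss_def by measurable

lemma gauss_nonneg [simp]: "0 \<le> gauss t x"
  by (simp add: gauss_def)

lemma exp_norm_prod:
  fixes x :: "'a::euclidean_space"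
  shows "exp (c * (norm x)\<^sup>2) = (\<Prod>b\<in>Basis. exp (c * (x \<bullet> b)\<^sup>2))"
proof -
  have "(norm x)\<^sup>2 = (\<Sum>b\<in>Basis. (x \<bullet> b)\<^sup>2)"
    unfolding power2_norm_eq_inner by (subst euclidean_inner) (simp add: power2_eq_square)
  then show ?thesis
    by (simp add: sum_distrib_left exp_sum)
qed

lemma powr_DIM_half:
  assumes "t > 0"
  shows "t powr (- real DIM('a::euclidean_space) / 2) = (\<Prod>b\<in>(Basis::'a set). 1 / sqrt t)"
proof -
  have "t powr (- real DIM('a) / 2) = (t powr (-1/2)) powr real DIM('a)"
    by (simp add: powr_powr)
  also have "t powr (-1/2) = 1 / sqrt t"
    using assms by (simp add: powr_minus_divide powr_half_sqrt)
  finally show ?thesis using assms by (simp add: powr_realpow)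
qed

lemma gauss_prod:
  fixes x :: "'a::euclidean_space"
  assumes "t > 0"
  shows "gauss t x = (\<Prod>b\<in>Basis. normal_density 0 (sqrt (t / (2 * pi))) (x \<bullet> b))"
proof -
  have "gauss t x = exp (- pi / t * (norm x)\<^sup>2) * t powr (- real DIM('a) / 2)"
    by (simp add: gauss_def)
  also have "\<dots> = (\<Prod>b\<in>Basis. exp (- pi / t * (x \<bullet> b)\<^sup>2) * (1 / sqrt t))"
    unfolding exp_norm_prod powr_DIM_half[OF assms] by (simp only: prod.distrib)
  also have "\<dots> = (\<Prod>b\<in>Basis. normal_density 0 (sqrt (t / (2 * pi))) (x \<bullet> b))"
    using assms by (intro prod.cong refl) (simp add: normal_density_def field_simps)
  finally show ?thesis .
qed

lemma nn_integral_gauss: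
  assumes "t > 0"
  shows "(\<integral>\<^sup>+x. ennreal (gauss t x) \<partial>(lborel::'a::euclidean_space measure)) = 1"
proof -
  have "(\<integral>\<^sup>+x. ennreal (normal_density 0 \<sigma> x) \<partial>lborel) = 1" if "\<sigma> > 0" for \<sigma>
    using that by (subst nn_integral_eq_integral) (auto simp: integral_normal_density)
  then show ?thesis using assms
    by (simp add: gauss_prod flip: prod_ennreal) (subst nn_integral_lborel_prod, auto)
qed

text \<open>Variances add when centred normal densities are convolved. Gaussians factor over the
  coordinates, so dimension one suffices; there a translation by \<open>b\<close> and evenness bring
  the integral into the form of \<open>conv_normal_density_zero_mean\<close>.\<close>

lemma gauss_conv:
  fixes y z :: "'a::euclidean_space"
  assumes "s > 0" "t > 0"
  shows "(\<integral>\<^sup>+x. ennreal (gauss s (x - y)) * ennreal (gauss t (x - z)) \<partial>lborel) = ennreal (gauss (s + t) (y - z))"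
proof -
  define \<sigma> \<tau> where "\<sigma> = sqrt (s / (2 * pi))" and "\<tau> = sqrt (t / (2 * pi))"
  have pos: "\<sigma> > 0" "\<tau> > 0" using assms by (auto simp: \<sigma>_def \<tau>_def)
  have *: "sqrt (\<sigma>\<^sup>2 + \<tau>\<^sup>2) = sqrt ((s + t) / (2 * pi))"
    using assms by (simp add: \<sigma>_def \<tau>_def add_divide_distrib)
  have one: "(\<integral>\<^sup>+x. ennreal (normal_density 0 \<sigma> (x - a) * normal_density 0 \<tau> (x - b)) \<partial>lborel)
      = ennreal (normal_density 0 (sqrt ((s + t) / (2 * pi))) (a - b))" for a b
  proof -
    have "(\<integral>\<^sup>+x. ennreal (normal_density 0 \<sigma> (x - a) * normal_density 0 \<tau> (x - b)) \<partial>lborel)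
       = (\<integral>\<^sup>+x. ennreal (normal_density 0 \<sigma> (b + 1 * x - a) * normal_density 0 \<tau> (b + 1 * x - b)) \<partial>lborel)"
      by (subst nn_integral_real_affine[where c=1 and t=b]) auto
    also have "\<dots> = (\<integral>\<^sup>+x. ennreal (normal_density 0 \<sigma> ((a - b) - x) * normal_density 0 \<tau> x) \<partial>lborel)"
      by (intro nn_integral_cong) (simp add: normal_density_def power2_commute algebra_simps)
    also have "\<dots> = ennreal (normal_density 0 (sqrt (\<sigma>\<^sup>2 + \<tau>\<^sup>2)) (a - b))"
      using fun_cong[OF conv_normal_density_zero_mean[OF pos], of "a - b"] by simp
    finally show ?thesis by (simp only: *)
  qed
  have "(\<integral>\<^sup>+x. ennreal (gauss s (x - y)) * ennreal (gauss t (x - z)) \<partial>lborel)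
     = (\<integral>\<^sup>+x. (\<Prod>b\<in>Basis. ennreal (normal_density 0 \<sigma> (x \<bullet> b - y \<bullet> b) * normal_density 0 \<tau> (x \<bullet> b - z \<bullet> b))) \<partial>lborel)"
    using assms by (intro nn_integral_cong)
      (simp add: gauss_prod prod.distrib inner_diff_left \<sigma>_def \<tau>_def prod_ennreal prod_nonneg flip: ennreal_mult)
  also have "\<dots> = (\<Prod>b\<in>Basis. ennreal (normal_density 0 (sqrt ((s + t) / (2 * pi))) (y \<bullet> b - z \<bullet> b)))"
    by (subst nn_integral_lborel_prod) (auto simp: one)
  also have "\<dots> = ennreal (gauss (s + t) (y - z))"
    using assms by (simp add: gauss_prod inner_diff_left prod_ennreal)
  finally show ?thesis .
qed

section \<open>Fourier transforms of Gaussians\<close>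

lemma integral_cis_gaussian_real:
  assumes "t > 0"
  shows "integrable lborel (\<lambda>x. cis (- 2 * pi * (x * z)) * complex_of_real (exp (- pi * t * x\<^sup>2)))" (is ?A)
    and "(\<integral>x. cis (- 2 * pi * (x * z)) * complex_of_real (exp (- pi * t * x\<^sup>2)) \<partial>lborel)
       = complex_of_real (normal_density 0 (sqrt (t / (2 * pi))) z)" (is ?B)
proof -
  \<comment> \<open>Substituting \<open>c * x\<close> for \<open>x\<close> turns
    \<open>exp (- pi * t * x\<^sup>2)\<close> into a multiple of the standard normal density, whose
    characteristic function is known.\<close>
  define c where "c = 1 / sqrt (2 * pi * t)"
  have c: "c > 0" "c \<noteq> 0" using assms by (auto simp: c_def)
  have c2: "c\<^sup>2 = 1 / (2 * pi * t)" using assms by (simp add: c_def power_divide)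
  have [measurable]: "(\<lambda>x. cis (u * x)) \<in> borel_measurable borel" for u
    by (intro borel_measurable_continuous_onI continuous_intros)
  have int: "integrable lborel (\<lambda>x. normal_density 0 1 x *\<^sub>R cis (u * x))" for u
    by (rule Bochner_Integration.integrable_bound[of _ "normal_density 0 1"]) 
       (auto simp: norm_mult)
  have val: "(\<integral>x. normal_density 0 1 x *\<^sub>R cis (u * x) \<partial>lborel) = complex_of_real (exp (- u\<^sup>2 / 2))" for u
    using fun_cong[OF char_std_normal_distribution, of u]
    unfolding char_def by (subst (asm) integral_density) (auto simp: cis_conv_exp)
  have eq: "cis (- 2 * pi * ((0 + c * x) * z)) * complex_of_real (exp (- pi * t * (0 + c * x)\<^sup>2))
      = sqrt (2 * pi) *\<^sub>R (normal_density 0 1 x *\<^sub>R cis ((- 2 * pi * c * z) * x))" for x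
    using assms by (simp add: normal_density_def power_mult_distrib c2 scaleR_conv_of_real mult_ac
      flip: of_real_mult)
  show ?A
    by (subst lborel_integrable_real_affine_iff[OF c(2), of _ 0, symmetric]) (simp only: eq, intro integrable_scaleR_right int)
  have "(\<integral>x. cis (- 2 * pi * (x * z)) * complex_of_real (exp (- pi * t * x\<^sup>2)) \<partial>lborel)
     = \<bar>c\<bar> *\<^sub>R (\<integral>x. sqrt (2 * pi) *\<^sub>R (normal_density 0 1 x *\<^sub>R cis ((- 2 * pi * c * z) * x)) \<partial>lborel)"
    by (subst lborel_integral_real_affine[OF c(2), of _ 0]) (simp only: eq)
  also have "\<dots> = complex_of_real (c * sqrt (2 * pi) * exp (- (- 2 * pi * c * z)\<^sup>2 / 2))"
    using c(1) by (simp only: integral_scaleR_right val) (simp add: scaleR_conv_of_real)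
  also have "c * sqrt (2 * pi) * exp (- (- 2 * pi * c * z)\<^sup>2 / 2) = normal_density 0 (sqrt (t / (2 * pi))) z"
  proof -
    have "- (- 2 * pi * c * z)\<^sup>2 / 2 = - (z\<^sup>2 / (t / pi))"
    proof -
      have "(- 2 * pi * c * z)\<^sup>2 = 4 * pi\<^sup>2 * c\<^sup>2 * z\<^sup>2"
        by (simp add: power_mult_distrib)
      then show ?thesis
        unfolding c2 using assms by (simp add: field_simps power2_eq_square)
    qed
    moreover have "c * sqrt (2 * pi) = 1 / sqrt t"
      using assms by (simp add: c_def real_sqrt_mult)
    ultimately show ?thesis using assms by (simp add: normal_density_def)
  qed
  finally show ?B .
qed

text \<open>The character and the Gaussian both factor over the coordinates, which leaves the
  one-dimensional formula in each of them.\<close>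

lemma
  fixes z :: "'a::euclidean_space"
  assumes "t > 0"
  shows integrable_cis_gaussian:
      "integrable lborel (\<lambda>\<xi>. cis (- 2 * pi * (\<xi> \<bullet> z)) * complex_of_real (exp (- pi * t * (norm \<xi>)\<^sup>2)))"
    and integral_cis_gaussian:
      "(\<integral>\<xi>. cis (- 2 * pi * (\<xi> \<bullet> z)) * complex_of_real (exp (- pi * t * (norm \<xi>)\<^sup>2)) \<partial>lborel) = complex_of_real (gauss t z)"
proof -
  have eq: "cis (- 2 * pi * (\<xi> \<bullet> z)) * complex_of_real (exp (- pi * t * (norm \<xi>)\<^sup>2))
    = (\<Prod>b\<in>Basis. cis (- 2 * pi * ((\<xi> \<bullet> b) * (z \<bullet> b))) * complex_of_real (exp (- pi * t * (\<xi> \<bullet> b)\<^sup>2)))" for \<xi>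
  proof -
    have "cis (- 2 * pi * (\<xi> \<bullet> z)) = (\<Prod>b\<in>Basis. cis (- 2 * pi * ((\<xi> \<bullet> b) * (z \<bullet> b))))"
      by (subst euclidean_inner) (simp add: cis_conv_exp exp_sum sum_distrib_left)
    then show ?thesis unfolding exp_norm_prod by (simp add: prod.distrib)
  qed
  show "integrable lborel (\<lambda>\<xi>. cis (- 2 * pi * (\<xi> \<bullet> z)) * complex_of_real (exp (- pi * t * (norm \<xi>)\<^sup>2)))"
    unfolding eq using integral_cis_gaussian_real(1)[OF assms] by (intro integrable_lborel_prod)
  show "(\<integral>\<xi>. cis (- 2 * pi * (\<xi> \<bullet> z)) * complex_of_real (exp (- pi * t * (norm \<xi>)\<^sup>2)) \<partial>lborel) = complex_of_real (gauss t z)"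
    unfolding eq gauss_prod[OF assms] using integral_cis_gaussian_real[OF assms]
    by (subst integral_lborel_prod) simp_all
qed

section \<open>Fourier transforms of finite measures\<close>

text \<open>The normalisation of \<open>fourier_meas\<close>, for measures on a single copy of
  R^d.\<close>

definition ft :: "'a::euclidean_space measure \<Rightarrow> 'a \<Rightarrow> complex" where
  "ft M \<xi> = (\<integral>x. cis (- 2 * pi * (\<xi> \<bullet> x)) \<partial>M)"

lemma borel_measurable_cis [measurable (raw)]:
  "f \<in> borel_measurable M \<Longrightarrow> (\<lambda>x. cis (f x)) \<in> borel_measurable M"
  by (rule measurable_compose[of f M borel cis borel])
    (auto intro!: borel_measurable_continuous_onI continuous_intros)

lemma ft_measurable:
  assumes "finite_measure M" and [measurable_cong]: "sets M = sets borel"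
  shows "ft M \<in> borel_measurable borel"
proof -
  interpret finite_measure M by fact
  show ?thesis unfolding ft_def[abs_def] by measurable
qed

text \<open>The Gaussian is the transform of a frequency-side Gaussian, and the two integrals may be
  exchanged because \<open>M\<close> is finite and that Gaussian is integrable.\<close>

lemma integral_gauss_eq_ft:
  fixes M :: "'a::euclidean_space measure"
  assumes "finite_measure M" and [measurable_cong]: "sets M = sets borel" and "t > 0"
  shows "complex_of_real (\<integral>z. gauss t z \<partial>M)
    = (\<integral>\<xi>. ft M \<xi> * complex_of_real (exp (- pi * t * (norm \<xi>)\<^sup>2)) \<partial>lborel)"
proof -
  interpret M: finite_measure M by fact
  interpret pair_sigma_finite "lborel :: 'a measure" M ..
  define f where "f \<xi> z = cis (- 2 * pi * (\<xi> \<bullet> z)) * complex_of_real (exp (- pi * t * (norm \<xi>)\<^sup>2))" for \<xi> z :: 'a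
  have [measurable]: "case_prod f \<in> borel_measurable (lborel \<Otimes>\<^sub>M M)"
    unfolding f_def by measurable
  have "integrable lborel (\<lambda>\<xi>::'a. exp (- pi * t * (norm \<xi>)\<^sup>2))"
    using integrable_norm[OF integrable_cis_gaussian[OF \<open>t > 0\<close>, of 0]] by (simp add: norm_mult)
  then have "integrable (lborel \<Otimes>\<^sub>M M) (case_prod f)"
    using \<open>t > 0\<close> by (intro Fubini_integrable) (auto simp: f_def norm_mult intro!: AE_I2 M.integrable_const_bound[where B=1])
  then have "(\<integral>z. (\<integral>\<xi>. f \<xi> z \<partial>lborel) \<partial>M) = (\<integral>\<xi>. (\<integral>z. f \<xi> z \<partial>M) \<partial>lborel)"
    by (rule Fubini_integral)
  then show ?thesis
    by (simp only: f_def ft_def integral_cis_gaussian[OF \<open>t > 0\<close>] integral_mult_left_zero integral_complex_of_real)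
qed

text \<open>For finite measures this is the convolution of \<open>M\<close> with the reflection of
  \<open>N\<close>. Differences occur both in the form with integrand \<open>f x * g (x - w)\<close>
  and in the energy of a measure; on the frequency side they produce a factor
  \<open>cnj (ft N \<xi>)\<close>, hence a squared modulus when \<open>N = M\<close>.\<close>

definition diff_measure :: "'a::euclidean_space measure \<Rightarrow> 'a measure \<Rightarrow> 'a measure" where
  "diff_measure M N = distr (M \<Otimes>\<^sub>M N) borel (\<lambda>(x, y). x - y)"

context
  fixes M N :: "'a::euclidean_space measure"
  assumes M: "finite_measure M" and [measurable_cong]: "sets M = sets borel"
    and N: "finite_measure N" and [measurable_cong]: "sets N = sets borel"
begin

lemma sets_diff_measure [simp]: "sets (diff_measure M N) = sets borel"
  by (simp add: diff_measure_def)

lemma finite_measure_diff_measure: "finite_measure (diff_measure M N)"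
  unfolding diff_measure_def
  by (intro finite_measure.finite_measure_distr finite_measure_pair_measure M N) measurable

lemma nn_integral_diff_measure:
  assumes [measurable]: "f \<in> borel_measurable borel"
  shows "(\<integral>\<^sup>+z. f z \<partial>diff_measure M N) = (\<integral>\<^sup>+x. \<integral>\<^sup>+y. f (x - y) \<partial>N \<partial>M)"
proof -
  interpret N: finite_measure N by (rule N)
  show ?thesis unfolding diff_measure_def
    by (subst nn_integral_distr, measurable, subst N.nn_integral_fst[symmetric]) auto
qed

lemma ft_diff_measure: "ft (diff_measure M N) \<xi> = ft M \<xi> * cnj (ft N \<xi>)"
proof -
  interpret M: finite_measure M by (rule M)
  interpret N: finite_measure N by (rule N)
  interpret pair_sigma_finite M N ..
  interpret MN: finite_measure "M \<Otimes>\<^sub>M N" by (intro finite_measure_pair_measure M N)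
  have int: "integrable (M \<Otimes>\<^sub>M N) (\<lambda>p. cis (- 2 * pi * (\<xi> \<bullet> (fst p - snd p))))"
    by (rule MN.integrable_const_bound[where B=1]) auto
  have cis: "cis (- 2 * pi * (\<xi> \<bullet> (x - y))) = cis (- 2 * pi * (\<xi> \<bullet> x)) * cnj (cis (- 2 * pi * (\<xi> \<bullet> y)))" for x y
    by (simp add: cis_cnj cis_mult inner_diff_right algebra_simps)
  have "ft (diff_measure M N) \<xi> = (\<integral>p. cis (- 2 * pi * (\<xi> \<bullet> (fst p - snd p))) \<partial>(M \<Otimes>\<^sub>M N))"
    unfolding ft_def diff_measure_def by (subst integral_distr) (auto simp: case_prod_beta)
  also have "\<dots> = (\<integral>x. \<integral>y. cis (- 2 * pi * (\<xi> \<bullet> (x - y))) \<partial>N \<partial>M)"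
    using integral_fst'[OF int] by simp
  also have "\<dots> = ft M \<xi> * cnj (ft N \<xi>)"
    unfolding cis by (simp add: ft_def)
  finally show ?thesis .
qed

end

section \<open>Gaussian averages and energies on the frequency side\<close>

lemma nn_integral_gauss_eq_ft:
  fixes M :: "'a::euclidean_space measure"
  assumes M: "finite_measure M" and [measurable_cong]: "sets M = sets borel" and "t > 0"
  shows "(\<integral>\<^sup>+z. ennreal (gauss t z) \<partial>M)
    = ennreal (Re (\<integral>\<xi>. ft M \<xi> * complex_of_real (exp (- pi * t * (norm \<xi>)\<^sup>2)) \<partial>lborel))"
proof -
  interpret M: finite_measure M by (rule M)
  have bnd: "gauss t z \<le> t powr (- real DIM('a) / 2)" for z :: 'a
    using \<open>t > 0\<close> unfolding gauss_def by (intro mult_left_le_one_le) (auto simp: field_simps)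
  have "integrable M (gauss t)"
    by (rule M.integrable_const_bound[where B="t powr (- real DIM('a) / 2)"]) (use bnd in auto)
  then have "(\<integral>\<^sup>+z. ennreal (gauss t z) \<partial>M) = ennreal (\<integral>z. gauss t z \<partial>M)"
    by (intro nn_integral_eq_integral) auto
  then show ?thesis
    by (subst integral_gauss_eq_ft[OF M, symmetric]) (use assms in auto)
qed

lemma norm_integral_le_nn_integral:
  fixes f :: "'a \<Rightarrow> 'b::{banach, second_countable_topology}"
  shows "ennreal (norm (\<integral>x. f x \<partial>M)) \<le> (\<integral>\<^sup>+x. ennreal (norm (f x)) \<partial>M)"
  by (cases "integrable M f") (auto simp: integral_norm_bound_ennreal not_integrable_integral_eq)

text \<open>The frequency-side Gaussian is at most 1, so dropping it leaves a bound that is uniform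
  in \<open>t\<close>, possibly infinite.\<close>

lemma nn_integral_gauss_le_ft:
  fixes M :: "'a::euclidean_space measure"
  assumes "finite_measure M" "sets M = sets borel" "t > 0"
  shows "(\<integral>\<^sup>+z. ennreal (gauss t z) \<partial>M) \<le> (\<integral>\<^sup>+\<xi>. ennreal (norm (ft M \<xi>)) \<partial>lborel)"
proof -
  let ?f = "\<lambda>\<xi>. ft M \<xi> * complex_of_real (exp (- pi * t * (norm \<xi>)\<^sup>2))"
  have "(\<integral>\<^sup>+z. ennreal (gauss t z) \<partial>M) \<le> ennreal (norm (\<integral>\<xi>. ?f \<xi> \<partial>lborel))"
    unfolding nn_integral_gauss_eq_ft[OF assms] by (intro ennreal_leI complex_Re_le_cmod)
  also have "\<dots> \<le> (\<integral>\<^sup>+\<xi>. ennreal (norm (?f \<xi>)) \<partial>lborel)"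
    by (rule norm_integral_le_nn_integral)
  also have "\<dots> \<le> (\<integral>\<^sup>+\<xi>. ennreal (norm (ft M \<xi>)) \<partial>lborel)"
    using \<open>t > 0\<close> by (intro nn_integral_mono ennreal_leI) (auto simp: norm_mult intro!: mult_left_le)
  finally show ?thesis .
qed

text \<open>The left side is the Gaussian average of \<open>diff_measure M M\<close>, whose
  transform is the squared modulus of \<open>ft M\<close>. As this is nonnegative, the complex
  frequency integral turns into a nonnegative one, to which Tonelli applies freely later.\<close>

lemma nn_integral_gauss_energy:
  fixes M :: "'a::euclidean_space measure"
  assumes M: "finite_measure M" and sM [measurable_cong]: "sets M = sets borel" and "t > 0"
  shows "(\<integral>\<^sup>+x. \<integral>\<^sup>+y. ennreal (gauss t (x - y)) \<partial>M \<partial>M)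
    = (\<integral>\<^sup>+\<xi>. ennreal ((norm (ft M \<xi>))\<^sup>2 * exp (- pi * t * (norm \<xi>)\<^sup>2)) \<partial>lborel)"
proof -
  interpret M: finite_measure M by (rule M)
  note [measurable] = ft_measurable[OF M sM]
  \<comment> \<open>A transform is bounded by the total mass, so a multiple of the Gaussian
    dominates the integrand.\<close>
  have ftM: "norm (ft M \<xi>) \<le> measure M (space M)" for \<xi>
    unfolding ft_def using integral_norm_bound[of M "\<lambda>x. cis (- 2 * pi * (\<xi> \<bullet> x))"] by simp
  have gi: "integrable lborel (\<lambda>\<xi>::'a. exp (- pi * t * (norm \<xi>)\<^sup>2))"
    using integrable_norm[OF integrable_cis_gaussian[OF \<open>t > 0\<close>, of 0]] by (simp add: norm_mult)
  have int: "integrable lborel (\<lambda>\<xi>. (norm (ft M \<xi>))\<^sup>2 * exp (- pi * t * (norm \<xi>)\<^sup>2))"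
  proof (rule Bochner_Integration.integrable_bound)
    show "integrable lborel (\<lambda>\<xi>::'a. (measure M (space M))\<^sup>2 * exp (- pi * t * (norm \<xi>)\<^sup>2))"
      using gi by simp
    show "AE \<xi> in lborel. norm ((norm (ft M \<xi>))\<^sup>2 * exp (- pi * t * (norm \<xi>)\<^sup>2))
       \<le> norm ((measure M (space M))\<^sup>2 * exp (- pi * t * (norm \<xi>)\<^sup>2))"
      using ftM by (auto intro!: AE_I2 mult_right_mono power_mono simp: abs_mult)
  qed measurable
  have "(\<integral>\<^sup>+x. \<integral>\<^sup>+y. ennreal (gauss t (x - y)) \<partial>M \<partial>M)
     = (\<integral>\<^sup>+z. ennreal (gauss t z) \<partial>diff_measure M M)"
    by (subst nn_integral_diff_measure[OF M sM M sM]) auto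
  also have "\<dots> = ennreal (Re (\<integral>\<xi>. ft (diff_measure M M) \<xi> * complex_of_real (exp (- pi * t * (norm \<xi>)\<^sup>2)) \<partial>lborel))"
    using assms by (intro nn_integral_gauss_eq_ft finite_measure_diff_measure) (auto simp: sets_diff_measure)
  also have "(\<lambda>\<xi>. ft (diff_measure M M) \<xi> * complex_of_real (exp (- pi * t * (norm \<xi>)\<^sup>2)))
     = (\<lambda>\<xi>. complex_of_real ((norm (ft M \<xi>))\<^sup>2 * exp (- pi * t * (norm \<xi>)\<^sup>2)))"
    by (simp only: ft_diff_measure[OF M sM M sM] of_real_mult complex_norm_square)
  also have "ennreal (Re (\<integral>\<xi>. complex_of_real ((norm (ft M \<xi>))\<^sup>2 * exp (- pi * t * (norm \<xi>)\<^sup>2)) \<partial>lborel))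
     = (\<integral>\<^sup>+\<xi>. ennreal ((norm (ft M \<xi>))\<^sup>2 * exp (- pi * t * (norm \<xi>)\<^sup>2)) \<partial>lborel)"
    using int by (subst nn_integral_eq_integral) (auto simp del: of_real_mult of_real_power)
  finally show ?thesis .
qed

section \<open>Bessel potentials\<close>

lemma nn_integral_square:
  assumes [measurable]: "f \<in> borel_measurable M"
  shows "(\<integral>\<^sup>+x. f x \<partial>M)\<^sup>2 = (\<integral>\<^sup>+x. \<integral>\<^sup>+y. f x * f y \<partial>M \<partial>M :: ennreal)"
  by (simp add: power2_eq_square nn_integral_cmult nn_integral_multc)

text \<open>The mixing density over the widths \<open>t\<close> of the Gaussians that make up the
  Bessel kernel. The factor \<open>t powr (- d / 2)\<close> of the kernel's integrand has moved into
  \<open>gauss\<close>, which leaves an exponent free of the dimension d.\<close>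

definition bessel_weight :: "real \<Rightarrow> real \<Rightarrow> ennreal" where
  "bessel_weight s t = indicator {0<..} t * ennreal (exp (- t / (4 * pi)) * t powr (s / 2 - 1))"

lemma bessel_weight_measurable [measurable]: "bessel_weight s \<in> borel_measurable borel"
  unfolding bessel_weight_def[abs_def] by measurable

definition bessel_const :: "real \<Rightarrow> real" where
  "bessel_const s = 1 / ((4 * pi) powr (s / 2) * Gamma (s / 2))"

lemma bessel_kernel_eq:
  "bessel_kernel s (x::'a::euclidean_space)
    = ennreal (bessel_const s) * (\<integral>\<^sup>+t. bessel_weight s t * ennreal (gauss t x) \<partial>lborel)"
proof -
  have "indicator {0<..} t * ennreal (exp (- pi * (norm x)\<^sup>2 / t) * exp (- t / (4 * pi)) * t powr ((s - real DIM('a)) / 2 - 1))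
    = bessel_weight s t * ennreal (gauss t x)" for t
  proof (cases "t > 0")
    case True
    have "t powr ((s - real DIM('a)) / 2 - 1) = t powr (s / 2 - 1) * t powr (- real DIM('a) / 2)"
      by (simp add: diff_divide_distrib algebra_simps flip: powr_add)
    then show ?thesis
      using True by (simp add: bessel_weight_def gauss_def mult_ac flip: ennreal_mult)
  qed (simp add: bessel_weight_def)
  then show ?thesis
    by (simp add: bessel_kernel_def bessel_const_def)
qed

text \<open>The Fourier transform of the Bessel kernel, written by replacing each Gaussian of the
  superposition by its transform.\<close>

definition bessel_multiplier :: "real \<Rightarrow> 'a::euclidean_space \<Rightarrow> ennreal" where
  "bessel_multiplier s \<xi> = ennreal (bessel_const s) *
     (\<integral>\<^sup>+t. bessel_weight s t * ennreal (exp (- pi * t * (norm \<xi>)\<^sup>2)) \<partial>lborel)"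

text \<open>This is Plancherel's identity for the Bessel potential of \<open>M\<close>, with both
  sides possibly infinite. Squaring the superposition gives a double integral over widths
  \<open>t\<close> and \<open>t'\<close>; for each pair the spatial integral is a Gaussian energy,
  known on the frequency side. Every integrand is nonnegative, so Tonelli justifies all
  exchanges.\<close>

lemma bessel_potential_norm:
  fixes M :: "'a::euclidean_space measure"
  assumes M: "finite_measure M" and sM [measurable_cong]: "sets M = sets borel"
  shows "(\<integral>\<^sup>+x. (\<integral>\<^sup>+y. bessel_kernel s (x - y) \<partial>M)\<^sup>2 \<partial>lborel)
    = (\<integral>\<^sup>+\<xi>. ennreal ((norm (ft M \<xi>))\<^sup>2) * (bessel_multiplier s \<xi>)\<^sup>2 \<partial>lborel)"
proof -
  interpret M: finite_measure M by (rule M)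
  interpret LM: pair_sigma_finite "lborel :: 'a measure" M ..
  interpret RM: pair_sigma_finite "lborel :: real measure" M ..
  note [measurable] = ft_measurable[OF M sM]
  let ?c = "ennreal (bessel_const s)" and ?w = "bessel_weight s"
  \<comment> \<open>\<open>M\<close> smoothed by the Gaussian of width \<open>t\<close>.\<close>
  define \<Phi> where "\<Phi> t x = (\<integral>\<^sup>+y. ennreal (gauss t (x - y)) \<partial>M)" for t x
  have [measurable]: "(\<lambda>(t, x). \<Phi> t x) \<in> borel_measurable (borel \<Otimes>\<^sub>M borel)"
    unfolding \<Phi>_def by measurable
  have pot: "(\<integral>\<^sup>+y. bessel_kernel s (x - y) \<partial>M) = ?c * (\<integral>\<^sup>+t. ?w t * \<Phi> t x \<partial>lborel)" for x
  proof -
    have "(\<integral>\<^sup>+y. bessel_kernel s (x - y) \<partial>M)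
      = ?c * (\<integral>\<^sup>+y. \<integral>\<^sup>+t. ?w t * ennreal (gauss t (x - y)) \<partial>lborel \<partial>M)"
      unfolding bessel_kernel_eq by (subst nn_integral_cmult) auto
    also have "(\<integral>\<^sup>+y. \<integral>\<^sup>+t. ?w t * ennreal (gauss t (x - y)) \<partial>lborel \<partial>M)
      = (\<integral>\<^sup>+t. \<integral>\<^sup>+y. ?w t * ennreal (gauss t (x - y)) \<partial>M \<partial>lborel)"
      by (rule RM.Fubini') measurable
    also have "\<dots> = (\<integral>\<^sup>+t. ?w t * \<Phi> t x \<partial>lborel)"
      unfolding \<Phi>_def by (subst nn_integral_cmult) auto
    finally show ?thesis .
  qed
  \<comment> \<open>Integrating out \<open>x\<close> merges the two Gaussians into one of width
    \<open>t + t'\<close>. On the frequency side its exponential splits again into a factor for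
    \<open>t\<close> and one for \<open>t'\<close>.\<close>
  have energy: "(\<integral>\<^sup>+x. \<Phi> t x * \<Phi> t' x \<partial>lborel)
      = (\<integral>\<^sup>+\<xi>. ennreal ((norm (ft M \<xi>))\<^sup>2) * (ennreal (exp (- pi * t * (norm \<xi>)\<^sup>2)) * ennreal (exp (- pi * t' * (norm \<xi>)\<^sup>2))) \<partial>lborel)"
    if t: "t > 0" "t' > 0" for t t'
  proof -
    have "(\<integral>\<^sup>+x. \<Phi> t x * \<Phi> t' x \<partial>lborel)
      = (\<integral>\<^sup>+x. \<integral>\<^sup>+y. \<integral>\<^sup>+z. ennreal (gauss t (x - y)) * ennreal (gauss t' (x - z)) \<partial>M \<partial>M \<partial>lborel)"
      unfolding \<Phi>_def by (simp add: nn_integral_cmult nn_integral_multc)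
    also have "\<dots> = (\<integral>\<^sup>+y. \<integral>\<^sup>+x. \<integral>\<^sup>+z. ennreal (gauss t (x - y)) * ennreal (gauss t' (x - z)) \<partial>M \<partial>lborel \<partial>M)"
      by (rule LM.Fubini'[symmetric]) measurable
    also have "\<dots> = (\<integral>\<^sup>+y. \<integral>\<^sup>+z. \<integral>\<^sup>+x. ennreal (gauss t (x - y)) * ennreal (gauss t' (x - z)) \<partial>lborel \<partial>M \<partial>M)"
      by (intro nn_integral_cong LM.Fubini'[symmetric]) measurable
    also have "\<dots> = (\<integral>\<^sup>+y. \<integral>\<^sup>+z. ennreal (gauss (t + t') (y - z)) \<partial>M \<partial>M)"
      using t by (simp add: gauss_conv)
    also have "\<dots> = (\<integral>\<^sup>+\<xi>. ennreal ((norm (ft M \<xi>))\<^sup>2 * exp (- pi * (t + t') * (norm \<xi>)\<^sup>2)) \<partial>lborel)"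
      using t by (intro nn_integral_gauss_energy M sM) auto
    also have "\<dots> = (\<integral>\<^sup>+\<xi>. ennreal ((norm (ft M \<xi>))\<^sup>2) * (ennreal (exp (- pi * t * (norm \<xi>)\<^sup>2)) * ennreal (exp (- pi * t' * (norm \<xi>)\<^sup>2))) \<partial>lborel)"
      by (intro nn_integral_cong) (simp add: algebra_simps exp_add exp_diff exp_minus field_simps flip: ennreal_mult)
    finally show ?thesis .
  qed
  have "(\<integral>\<^sup>+x. (\<integral>\<^sup>+y. bessel_kernel s (x - y) \<partial>M)\<^sup>2 \<partial>lborel)
    = ?c\<^sup>2 * (\<integral>\<^sup>+x. (\<integral>\<^sup>+t. \<integral>\<^sup>+t'. (?w t * ?w t') * (\<Phi> t x * \<Phi> t' x) \<partial>lborel \<partial>lborel) \<partial>lborel)"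
    unfolding pot power_mult_distrib
    by (subst nn_integral_cmult)
      (auto simp: nn_integral_square mult_ac)
  also have "(\<integral>\<^sup>+x. (\<integral>\<^sup>+t. \<integral>\<^sup>+t'. (?w t * ?w t') * (\<Phi> t x * \<Phi> t' x) \<partial>lborel \<partial>lborel) \<partial>lborel)
    = (\<integral>\<^sup>+t. \<integral>\<^sup>+x. (\<integral>\<^sup>+t'. (?w t * ?w t') * (\<Phi> t x * \<Phi> t' x) \<partial>lborel) \<partial>lborel \<partial>lborel)"
    by (rule lborel_pair.Fubini') measurable
  also have "\<dots> = (\<integral>\<^sup>+t. \<integral>\<^sup>+t'. \<integral>\<^sup>+x. (?w t * ?w t') * (\<Phi> t x * \<Phi> t' x) \<partial>lborel \<partial>lborel \<partial>lborel)"
    by (intro nn_integral_cong lborel_pair.Fubini') measurable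
  also have "\<dots> = (\<integral>\<^sup>+t. \<integral>\<^sup>+t'. \<integral>\<^sup>+\<xi>. (?w t * ?w t') * (ennreal ((norm (ft M \<xi>))\<^sup>2) * (ennreal (exp (- pi * t * (norm \<xi>)\<^sup>2)) * ennreal (exp (- pi * t' * (norm \<xi>)\<^sup>2)))) \<partial>lborel \<partial>lborel \<partial>lborel)"
  proof (rule nn_integral_cong, rule nn_integral_cong)
    fix t t' :: real
    show "(\<integral>\<^sup>+x. (?w t * ?w t') * (\<Phi> t x * \<Phi> t' x) \<partial>lborel)
      = (\<integral>\<^sup>+\<xi>. (?w t * ?w t') * (ennreal ((norm (ft M \<xi>))\<^sup>2) * (ennreal (exp (- pi * t * (norm \<xi>)\<^sup>2)) * ennreal (exp (- pi * t' * (norm \<xi>)\<^sup>2)))) \<partial>lborel)"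
    \<comment> \<open>The energy identity concerns positive widths; otherwise one of the weights
      vanishes and both sides are 0.\<close>
    proof (cases "t > 0 \<and> t' > 0")
      case True
      then show ?thesis
        by (subst (1 2) nn_integral_cmult) (auto simp: energy)
    qed (auto simp: bessel_weight_def)
  qed
  \<comment> \<open>Moving the frequency integral outermost leaves a product integrand in
    \<open>t\<close> and \<open>t'\<close>, whose double integral is a square again.\<close>
  also have "\<dots> = (\<integral>\<^sup>+t. \<integral>\<^sup>+\<xi>. \<integral>\<^sup>+t'. (?w t * ?w t') * (ennreal ((norm (ft M \<xi>))\<^sup>2) * (ennreal (exp (- pi * t * (norm \<xi>)\<^sup>2)) * ennreal (exp (- pi * t' * (norm \<xi>)\<^sup>2)))) \<partial>lborel \<partial>lborel \<partial>lborel)"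
    by (intro nn_integral_cong lborel_pair.Fubini'[symmetric]) measurable
  also have "\<dots> = (\<integral>\<^sup>+\<xi>. \<integral>\<^sup>+t. \<integral>\<^sup>+t'. (?w t * ?w t') * (ennreal ((norm (ft M \<xi>))\<^sup>2) * (ennreal (exp (- pi * t * (norm \<xi>)\<^sup>2)) * ennreal (exp (- pi * t' * (norm \<xi>)\<^sup>2)))) \<partial>lborel \<partial>lborel \<partial>lborel)"
    by (rule lborel_pair.Fubini'[symmetric]) measurable
  also have "\<dots> = (\<integral>\<^sup>+\<xi>. ennreal ((norm (ft M \<xi>))\<^sup>2) *
      (\<integral>\<^sup>+t. ?w t * ennreal (exp (- pi * t * (norm \<xi>)\<^sup>2)) \<partial>lborel)\<^sup>2 \<partial>lborel)"
  proof (rule nn_integral_cong)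
    fix \<xi> :: 'a
    define A where "A = ennreal ((norm (ft M \<xi>))\<^sup>2)"
    define F where "F t = ?w t * ennreal (exp (- pi * t * (norm \<xi>)\<^sup>2))" for t
    have [measurable]: "F \<in> borel_measurable borel"
      unfolding F_def by measurable
    have "(\<integral>\<^sup>+t. \<integral>\<^sup>+t'. (?w t * ?w t') * (A * (ennreal (exp (- pi * t * (norm \<xi>)\<^sup>2)) * ennreal (exp (- pi * t' * (norm \<xi>)\<^sup>2)))) \<partial>lborel \<partial>lborel)
      = (\<integral>\<^sup>+t. \<integral>\<^sup>+t'. A * (F t * F t') \<partial>lborel \<partial>lborel)"
      unfolding F_def by (intro nn_integral_cong) (simp add: mult_ac)
    also have "\<dots> = A * (\<integral>\<^sup>+t. F t \<partial>lborel)\<^sup>2"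
      by (simp add: power2_eq_square nn_integral_cmult nn_integral_multc)
    finally show "(\<integral>\<^sup>+t. \<integral>\<^sup>+t'. (?w t * ?w t') * (ennreal ((norm (ft M \<xi>))\<^sup>2) * (ennreal (exp (- pi * t * (norm \<xi>)\<^sup>2)) * ennreal (exp (- pi * t' * (norm \<xi>)\<^sup>2)))) \<partial>lborel \<partial>lborel)
      = ennreal ((norm (ft M \<xi>))\<^sup>2) * (\<integral>\<^sup>+t. ?w t * ennreal (exp (- pi * t * (norm \<xi>)\<^sup>2)) \<partial>lborel)\<^sup>2"
      by (simp only: A_def F_def)
  qed
  also have "?c\<^sup>2 * \<dots> = (\<integral>\<^sup>+\<xi>. ?c\<^sup>2 * (ennreal ((norm (ft M \<xi>))\<^sup>2) *
      (\<integral>\<^sup>+t. ?w t * ennreal (exp (- pi * t * (norm \<xi>)\<^sup>2)) \<partial>lborel)\<^sup>2) \<partial>lborel)"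
    by (rule nn_integral_cmult[symmetric]) measurable
  also have "\<dots> = (\<integral>\<^sup>+\<xi>. ennreal ((norm (ft M \<xi>))\<^sup>2) * (bessel_multiplier s \<xi>)\<^sup>2 \<partial>lborel)"
    unfolding bessel_multiplier_def power_mult_distrib by (simp only: mult.left_commute)
  finally show ?thesis .
qed

text \<open>The integrand is bounded below on \<open>[a, 2a]\<close>, where \<open>a = (1 + |\<xi>|)\<^sup>-\<^sup>2\<close>;
  this avoids computing the multiplier \<open>(1 + 4 \<pi>\<^sup>2 |\<xi>|\<^sup>2)\<^sup>-\<^sup>s\<^sup>/\<^sup>2\<close> exactly.\<close>

lemma bessel_multiplier_ge:
  assumes "s > 0"
  obtains c where "c > 0" "\<And>\<xi>::'a::euclidean_space. ennreal (c * (1 + norm \<xi>) powr - s) \<le> bessel_multiplier s \<xi>"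
proof
  \<comment> \<open>For \<open>t\<close> between \<open>a\<close> and \<open>2 * a\<close>, the two
    exponentials bound the damping factor and the Gaussian from below, and the 2 comes from dividing
    by \<open>t \<le> 2 * a\<close>.\<close>
  define e where "e = exp (- 1) * exp (- (2 * pi)) / 2"
  have e: "e > 0" by (simp add: e_def)
  have bc: "bessel_const s > 0"
    using assms by (simp add: bessel_const_def Gamma_real_pos)
  show "bessel_const s * e > 0" using e bc by simp
  show "ennreal (bessel_const s * e * (1 + norm \<xi>) powr - s) \<le> bessel_multiplier s \<xi>" for \<xi> :: 'a
  proof -
    define a where "a = 1 / (1 + norm \<xi>)\<^sup>2"
    have np: "1 + norm \<xi> > 0" by (simp add: add_pos_nonneg)
    have a: "a > 0" "a \<le> 1" using np by (auto simp: a_def one_le_power)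
    have an: "a * (norm \<xi>)\<^sup>2 \<le> 1"
      using np by (auto simp: a_def divide_le_eq intro!: power_mono)
    have as: "a powr (s / 2) = (1 + norm \<xi>) powr - s"
    proof -
      have "a = (1 + norm \<xi>) powr (- 2)"
        using np by (simp add: a_def powr_minus_divide powr_numeral)
      then show ?thesis by (simp add: powr_powr)
    qed
    have low: "e * a powr (s / 2) / a \<le> exp (- t / (4 * pi)) * t powr (s / 2 - 1) * exp (- pi * t * (norm \<xi>)\<^sup>2)"
      if t: "a \<le> t" "t \<le> 2 * a" for t
    proof -
      have "t > 0" using a t by simp
      have "t \<le> 4 * pi" using t a pi_gt3 by simp
      then have 1: "exp (- 1) \<le> exp (- t / (4 * pi))" using pi_gt_zero by (simp add: field_simps)
      have "t * (norm \<xi>)\<^sup>2 \<le> 2 * a * (norm \<xi>)\<^sup>2" using t by (intro mult_right_mono) auto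
      with an have "t * (norm \<xi>)\<^sup>2 \<le> 2" by simp
      then have 2: "exp (- (2 * pi)) \<le> exp (- pi * t * (norm \<xi>)\<^sup>2)" 
        using pi_gt_zero by (simp add: mult.assoc)
      \<comment> \<open>Estimating \<open>t powr (s / 2)\<close> and \<open>1 / t\<close> separately
        avoids a case distinction on the sign of \<open>s / 2 - 1\<close>.\<close>
      have "a powr (s / 2) / (2 * a) \<le> t powr (s / 2) / t"
        using a t \<open>t > 0\<close> assms by (intro frac_le powr_mono2) auto
      also have "\<dots> = t powr (s / 2 - 1)"
        using \<open>t > 0\<close> by (simp add: powr_diff)
      finally have 3: "a powr (s / 2) / (2 * a) \<le> t powr (s / 2 - 1)" .
      have "exp (- 1) * (a powr (s / 2) / (2 * a)) * exp (- (2 * pi))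
         \<le> exp (- t / (4 * pi)) * t powr (s / 2 - 1) * exp (- pi * t * (norm \<xi>)\<^sup>2)"
        using a by (intro mult_mono 1 2 3) auto
      then show ?thesis by (simp add: e_def field_simps)
    qed
    \<comment> \<open>The interval has length \<open>a\<close>, which cancels the denominator and
      leaves \<open>a powr (s / 2)\<close>, the desired power of
      \<open>1 + norm \<xi>\<close>.\<close>
    have "ennreal (e * a powr (s / 2)) = (\<integral>\<^sup>+t. ennreal (e * a powr (s / 2) / a) * indicator {a..2 * a} t \<partial>lborel)"
      using a e by (subst nn_integral_cmult_indicator) (auto simp flip: ennreal_mult)
    also have "\<dots> \<le> (\<integral>\<^sup>+t. bessel_weight s t * ennreal (exp (- pi * t * (norm \<xi>)\<^sup>2)) \<partial>lborel)"
      using a low by (intro nn_integral_mono)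
        (auto simp: bessel_weight_def split: split_indicator simp flip: ennreal_mult intro!: ennreal_leI)
    finally have "ennreal (bessel_const s) * ennreal (e * a powr (s / 2)) \<le> bessel_multiplier s \<xi>"
      unfolding bessel_multiplier_def by (intro mult_left_mono) auto
    then show ?thesis
      using bc e by (simp add: as mult_ac flip: ennreal_mult)
  qed
qed

text \<open>Transforms have to be controlled by potentials, so Plancherel is combined with the lower
  bound on the multiplier. The constant is fixed before \<open>M\<close>.\<close>

lemma bessel_potential_norm_ge:
  assumes "s > 0"
  obtains c where "c > 0"
    and "\<And>M :: 'a::euclidean_space measure. finite_measure M \<Longrightarrow> sets M = sets borel \<Longrightarrow>
      (\<integral>\<^sup>+\<xi>. (ennreal (norm (ft M \<xi>) * (1 + norm \<xi>) powr - s))\<^sup>2 \<partial>lborel)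
        \<le> ennreal c * (\<integral>\<^sup>+x. (\<integral>\<^sup>+y. bessel_kernel s (x - y) \<partial>M)\<^sup>2 \<partial>lborel)"
proof -
  obtain c where c: "c > 0" "\<And>\<xi>::'a. ennreal (c * (1 + norm \<xi>) powr - s) \<le> bessel_multiplier s \<xi>"
    using bessel_multiplier_ge[OF assms] by metis
  show thesis
  proof
    show "(1 / c)\<^sup>2 > 0" using c by simp
    fix M :: "'a measure" assume M: "finite_measure M" and sM [measurable_cong]: "sets M = sets borel"
    note [measurable] = ft_measurable[OF M sM]
    have [measurable]: "bessel_multiplier s \<in> borel_measurable (borel :: 'a measure)"
      unfolding bessel_multiplier_def[abs_def] by measurable
    have "(\<integral>\<^sup>+\<xi>. (ennreal (norm (ft M \<xi>) * (1 + norm \<xi>) powr - s))\<^sup>2 \<partial>lborel)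
      \<le> (\<integral>\<^sup>+\<xi>. ennreal ((1 / c)\<^sup>2) * (ennreal ((norm (ft M \<xi>))\<^sup>2) * (bessel_multiplier s \<xi>)\<^sup>2) \<partial>lborel)"
    proof (intro nn_integral_mono)
      fix \<xi> :: 'a
      have "(ennreal (norm (ft M \<xi>) * (1 + norm \<xi>) powr - s))\<^sup>2
        = ennreal ((1 / c)\<^sup>2) * (ennreal ((norm (ft M \<xi>))\<^sup>2) * (ennreal (c * (1 + norm \<xi>) powr - s))\<^sup>2)"
        using c(1) by (simp add: power_mult_distrib power_divide ennreal_power flip: ennreal_mult)
      also have "\<dots> \<le> ennreal ((1 / c)\<^sup>2) * (ennreal ((norm (ft M \<xi>))\<^sup>2) * (bessel_multiplier s \<xi>)\<^sup>2)"
        by (intro mult_left_mono power_mono c) auto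
      finally show "(ennreal (norm (ft M \<xi>) * (1 + norm \<xi>) powr - s))\<^sup>2 \<le> \<dots>" .
    qed
    also have "\<dots> = ennreal ((1 / c)\<^sup>2) * (\<integral>\<^sup>+x. (\<integral>\<^sup>+y. bessel_kernel s (x - y) \<partial>M)\<^sup>2 \<partial>lborel)"
      unfolding bessel_potential_norm[OF M sM] by (rule nn_integral_cmult) measurable
    finally show "(\<integral>\<^sup>+\<xi>. (ennreal (norm (ft M \<xi>) * (1 + norm \<xi>) powr - s))\<^sup>2 \<partial>lborel) \<le> \<dots>" .
  qed
qed

section \<open>Removing the Gaussian mollification\<close>

lemma liminf_cmult_ennreal_le:
  fixes u :: "nat \<Rightarrow> ennreal"
  shows "c * liminf u \<le> liminf (\<lambda>n. c * u n)"
  unfolding liminf_SUP_INF SUP_mult_left_ennreal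
  by (intro SUP_mono' INF_greatest mult_left_mono INF_lower) auto

lemma liminf_add_ennreal_le:
  fixes u v :: "nat \<Rightarrow> ennreal"
  shows "liminf u + liminf v \<le> liminf (\<lambda>n. u n + v n)"
proof -
  have inc: "incseq (\<lambda>n. INF m\<in>{n..}. u m)" for u :: "nat \<Rightarrow> ennreal"
    by (auto intro!: monoI INF_superset_mono)
  show ?thesis
    unfolding liminf_SUP_INF ennreal_SUP_add[OF inc inc, symmetric]
    by (intro SUP_mono' INF_greatest add_mono INF_lower) auto
qed

section \<open>Affine substitutions and Gaussian dilations\<close>

lemma nn_integral_lborel_affine:
  fixes f :: "'a::euclidean_space \<Rightarrow> ennreal"
  assumes [measurable]: "f \<in> borel_measurable borel" and "c \<noteq> 0"
  shows "(\<integral>\<^sup>+x. f x \<partial>lborel) = (\<integral>\<^sup>+x. ennreal (\<bar>c\<bar> ^ DIM('a)) * f (t + c *\<^sub>R x) \<partial>lborel)"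
  by (subst lborel_affine[OF assms(2), of t]) (simp add: nn_integral_density nn_integral_distr)

lemma nn_integral_lborel_diff:
  fixes f :: "'a::euclidean_space \<Rightarrow> ennreal"
  assumes [measurable]: "f \<in> borel_measurable borel"
  shows "(\<integral>\<^sup>+x. f (x - t) \<partial>lborel) = (\<integral>\<^sup>+x. f x \<partial>lborel)"
  using nn_integral_lborel_affine[of f 1 "- t"] by simp

text \<open>Dilating space by \<open>c\<close> multiplies the width by \<open>c\<^sup>2\<close>;
  this is why the mollifiers below have squared widths.\<close>

lemma gauss_scale:
  fixes x :: "'a::euclidean_space"
  assumes "c > 0"
  shows "c ^ DIM('a) * gauss (c\<^sup>2) (c *\<^sub>R x) = gauss 1 x"
proof -
  have "(c\<^sup>2) powr (- real DIM('a) / 2) = c powr (- real DIM('a))"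
    using assms by (simp add: powr_powr flip: powr_numeral)
  also have "\<dots> = 1 / c ^ DIM('a)"
    using assms by (simp add: powr_minus_divide powr_realpow)
  finally show ?thesis
    using assms by (simp add: gauss_def power_mult_distrib)
qed

lemma gauss_minus [simp]: "gauss t (- x) = gauss t x"
  by (simp add: gauss_def)

text \<open>After rescaling, the mollified indicator at \<open>p\<close> is the average of
  \<open>indicator U (p + z / (n + 1))\<close> against one fixed Gaussian in \<open>z\<close>. If
  \<open>p\<close> lies in the open set \<open>U\<close>, these points are eventually in
  \<open>U\<close> for every \<open>z\<close>, and Fatou's lemma applies.\<close>

lemma gauss_mollify_open:
  fixes U :: "'a::euclidean_space set"
  assumes "open U"
  shows "indicator U p \<le> liminf (\<lambda>n. \<integral>\<^sup>+y. indicator U y * ennreal (gauss ((1 / real (Suc n))\<^sup>2) (p - y)) \<partial>lborel)"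
proof -
  have [measurable]: "U \<in> sets borel" using assms by simp
  have "indicator U p = (\<integral>\<^sup>+z. ennreal (gauss 1 z) * indicator U p \<partial>(lborel::'a measure))"
    by (subst nn_integral_multc) (auto simp: nn_integral_gauss)
  also have "\<dots> \<le> (\<integral>\<^sup>+z. liminf (\<lambda>n. ennreal (gauss 1 z) * indicator U (p + (1 / real (Suc n)) *\<^sub>R z)) \<partial>lborel)"
  proof (intro nn_integral_mono)
    fix z :: 'a
    show "ennreal (gauss 1 z) * indicator U p \<le> liminf (\<lambda>n. ennreal (gauss 1 z) * indicator U (p + (1 / real (Suc n)) *\<^sub>R z))"
    proof (cases "p \<in> U")
      case True
      have "(\<lambda>n. p + (1 / real (Suc n)) *\<^sub>R z) \<longlonglongrightarrow> p + 0 *\<^sub>R z"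
        by (intro tendsto_intros LIMSEQ_Suc lim_1_over_n)
      then have "eventually (\<lambda>n. p + (1 / real (Suc n)) *\<^sub>R z \<in> U) sequentially"
        using True assms by (intro topological_tendstoD) auto
      then have "eventually (\<lambda>n. ennreal (gauss 1 z) * indicator U p \<le> ennreal (gauss 1 z) * indicator U (p + (1 / real (Suc n)) *\<^sub>R z)) sequentially"
        by eventually_elim (simp add: indicator_def)
      then show ?thesis by (rule Liminf_bounded)
    qed simp
  qed
  also have "\<dots> \<le> liminf (\<lambda>n. \<integral>\<^sup>+z. ennreal (gauss 1 z) * indicator U (p + (1 / real (Suc n)) *\<^sub>R z) \<partial>lborel)"
    by (rule nn_integral_liminf) measurable
  also have "(\<lambda>n. \<integral>\<^sup>+z. ennreal (gauss 1 z) * indicator U (p + (1 / real (Suc n)) *\<^sub>R z) \<partial>lborel)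
    = (\<lambda>n. \<integral>\<^sup>+y. indicator U y * ennreal (gauss ((1 / real (Suc n))\<^sup>2) (p - y)) \<partial>lborel)"
  proof
    fix n
    define c where "c = 1 / real (Suc n)"
    have c: "c > 0" by (simp add: c_def)
    have "(\<integral>\<^sup>+y. indicator U y * ennreal (gauss (c\<^sup>2) (p - y)) \<partial>lborel)
      = (\<integral>\<^sup>+z. ennreal (\<bar>c\<bar> ^ DIM('a)) * (indicator U (p + c *\<^sub>R z) * ennreal (gauss (c\<^sup>2) (p - (p + c *\<^sub>R z)))) \<partial>lborel)"
      using c by (intro nn_integral_lborel_affine) auto
    also have "\<dots> = (\<integral>\<^sup>+z. ennreal (gauss 1 z) * indicator U (p + c *\<^sub>R z) \<partial>lborel)"
      using c by (intro nn_integral_cong)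
        (simp add: gauss_scale[OF c, symmetric] ennreal_mult mult_ac)
    finally show "(\<integral>\<^sup>+z. ennreal (gauss 1 z) * indicator U (p + c *\<^sub>R z) \<partial>lborel)
      = (\<integral>\<^sup>+y. indicator U y * ennreal (gauss (c\<^sup>2) (p - y)) \<partial>lborel)" by simp
  qed
  finally show ?thesis .
qed

text \<open>Fatou's lemma only handles indicators of open sets; outer regularity passes to Borel sets,
  the error being controlled because mollification does not increase the bound \<open>B\<close>.\<close>

lemma gauss_mollify_liminf:
  fixes Q :: "'a::euclidean_space measure"
  assumes Q: "finite_measure Q" and sQ [measurable_cong]: "sets Q = sets borel"
    and B: "\<And>A. A \<in> sets borel \<Longrightarrow> emeasure Q A \<le> ennreal B * emeasure lborel A"
    and g: "g \<in> borel_measurable borel"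
  shows "(\<integral>\<^sup>+p. g p \<partial>Q)
    \<le> liminf (\<lambda>n. \<integral>\<^sup>+p. \<integral>\<^sup>+y. g y * ennreal (gauss ((1 / real (Suc n))\<^sup>2) (p - y)) \<partial>lborel \<partial>Q)"
proof -
  interpret Q: finite_measure Q by (rule Q)
  interpret LQ: pair_sigma_finite "lborel :: 'a measure" Q ..
  define E where "E t g = (\<integral>\<^sup>+p. \<integral>\<^sup>+y. g y * ennreal (gauss t (p - y)) \<partial>lborel \<partial>Q)" for t and g :: "'a \<Rightarrow> ennreal"
  define r where "r n = (1 / real (Suc n))\<^sup>2" for n
  have r: "r n > 0" for n by (simp add: r_def)
  \<comment> \<open>Domination on sets is domination of measures, and thus passes to nonnegative
    integrals.\<close>
  have "(\<integral>\<^sup>+p. f p \<partial>Q) \<le> ennreal B * (\<integral>\<^sup>+p. f p \<partial>lborel)" if [measurable]: "f \<in> borel_measurable borel" for f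
  proof -
    have "Q \<le> scale_measure (ennreal B) lborel"
      using B sQ by (subst le_measure) auto
    then have "(\<integral>\<^sup>+p. f p \<partial>Q) \<le> (\<integral>\<^sup>+p. f p \<partial>scale_measure (ennreal B) lborel)"
      using sQ by (intro nn_integral_mono_measure) auto
    then show ?thesis by (simp add: nn_integral_scale_measure)
  qed
  note Q_le = this
  \<comment> \<open>Tonelli lets the Gaussian act on \<open>Q\<close> instead of on
    \<open>A\<close>. There it contributes at most \<open>B\<close>, since \<open>Q\<close> is
    dominated by \<open>B\<close> times Lebesgue measure and the Gaussian has mass 1.\<close>
  have E_le: "E (r n) (indicator A) \<le> ennreal B * emeasure lborel A" if [measurable]: "A \<in> sets borel" for A n
  proof -
    have "E (r n) (indicator A) = (\<integral>\<^sup>+y. \<integral>\<^sup>+p. indicator A y * ennreal (gauss (r n) (p - y)) \<partial>Q \<partial>lborel)"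
      unfolding E_def by (rule LQ.Fubini') measurable
    also have "\<dots> = (\<integral>\<^sup>+y. indicator A y * (\<integral>\<^sup>+p. ennreal (gauss (r n) (p - y)) \<partial>Q) \<partial>lborel)"
      by (simp add: nn_integral_cmult)
    also have "\<dots> \<le> (\<integral>\<^sup>+y. indicator A y * ennreal B \<partial>lborel)"
    proof (intro nn_integral_mono mult_left_mono)
      fix y :: 'a
      have "(\<integral>\<^sup>+p. ennreal (gauss (r n) (p - y)) \<partial>Q) \<le> ennreal B * (\<integral>\<^sup>+p. ennreal (gauss (r n) (p - y)) \<partial>lborel)"
        by (rule Q_le) measurable
      then show "(\<integral>\<^sup>+p. ennreal (gauss (r n) (p - y)) \<partial>Q) \<le> ennreal B"
        by (simp add: nn_integral_lborel_diff[of "\<lambda>x. ennreal (gauss (r n) x)"] nn_integral_gauss[OF r])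
    qed simp
    also have "\<dots> = ennreal B * emeasure lborel A"
      by (subst nn_integral_multc) (auto simp: mult.commute)
    finally show ?thesis .
  qed
  have mono: "E t u \<le> E t v" if "u \<le> v" for t u v
    unfolding E_def using that by (intro nn_integral_mono mult_right_mono) (auto simp: le_fun_def)
  have "(\<integral>\<^sup>+p. g p \<partial>Q) \<le> liminf (\<lambda>n. E (r n) g)"
    using g
  proof (induction g rule: borel_measurable_induct)
    case (cong f g)
    then have "f = g" by auto
    with cong show ?case by simp
  next
    case (set A)
    note [measurable] = set
    show ?case
    proof (rule ennreal_le_epsilon)
      fix e :: real assume "e > 0"
      \<comment> \<open>Dividing by \<open>\<bar>B\<bar> + 1\<close> keeps \<open>d\<close> positive
        for every real \<open>B\<close> and gives \<open>B * d \<le> e\<close>.\<close>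
      define d where "d = e / (\<bar>B\<bar> + 1)"
      have d: "d > 0" using \<open>e > 0\<close> by (simp add: d_def add_nonneg_pos)
      obtain U where U: "open U" "A \<subseteq> U" "emeasure lborel (U - A) < ennreal d"
        using outer_regular_lborel[OF set d] by metis
      have [measurable]: "U \<in> sets borel" using U by simp
      have "B * d \<le> e"
      proof -
        have "B * e \<le> (\<bar>B\<bar> + 1) * e"
          using \<open>e > 0\<close> by (intro mult_right_mono) auto
        moreover have "\<bar>B\<bar> + 1 > 0" by simp
        ultimately show ?thesis by (simp add: d_def divide_le_eq mult.commute)
      qed
      have "E (r n) (indicator U) \<le> E (r n) (indicator A) + ennreal e" for n
      proof -
        have "E (r n) (indicator U) = E (r n) (indicator A) + E (r n) (indicator (U - A))"
        proof -
          have "(indicator U y :: ennreal) = indicator A y + indicator (U - A) y" for y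
            using U(2) by (auto simp: indicator_def)
          then show ?thesis unfolding E_def
            by (simp add: distrib_right nn_integral_add)
        qed
        also have "E (r n) (indicator (U - A)) \<le> ennreal B * emeasure lborel (U - A)"
          by (rule E_le) measurable
        also have "\<dots> \<le> ennreal B * ennreal d"
          using U(3) by (intro mult_left_mono) auto
        also have "\<dots> \<le> ennreal e"
          using \<open>B * d \<le> e\<close> d by (cases "B \<ge> 0") (auto simp: ennreal_neg intro!: ennreal_leI simp flip: ennreal_mult)
        finally show ?thesis by (simp add: add_left_mono)
      qed
      note le = this
      have "(\<integral>\<^sup>+p. indicator A p \<partial>Q) \<le> (\<integral>\<^sup>+p. indicator U p \<partial>Q)"
        using U(2) by (intro nn_integral_mono) (auto simp: indicator_def)
      also have "\<dots> \<le> (\<integral>\<^sup>+p. liminf (\<lambda>n. \<integral>\<^sup>+y. indicator U y * ennreal (gauss (r n) (p - y)) \<partial>lborel) \<partial>Q)"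
        unfolding r_def by (intro nn_integral_mono gauss_mollify_open U)
      also have "\<dots> \<le> liminf (\<lambda>n. E (r n) (indicator U))"
        unfolding E_def by (intro nn_integral_liminf) measurable
      also have "\<dots> \<le> liminf (\<lambda>n. E (r n) (indicator A) + ennreal e)"
        by (intro Liminf_mono always_eventually allI le)
      also have "\<dots> = liminf (\<lambda>n. E (r n) (indicator A)) + ennreal e"
        by (intro Liminf_add_const) auto
      finally show "(\<integral>\<^sup>+p. indicator A p \<partial>Q) \<le> \<dots>" .
    qed
  next
    case (mult u c)
    have [measurable]: "u \<in> borel_measurable borel" using mult by auto
    have "E t (\<lambda>x. c * u x) = c * E t u" for t
      unfolding E_def by (simp add: nn_integral_cmult mult.assoc)
    moreover have "(\<integral>\<^sup>+p. c * u p \<partial>Q) \<le> c * liminf (\<lambda>n. E (r n) u)"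
      using mult by (subst nn_integral_cmult) (auto intro!: mult_left_mono)
    ultimately show ?case
      using liminf_cmult_ennreal_le[of c "\<lambda>n. E (r n) u"] by (auto intro: order_trans)
  next
    case (add u v)
    have [measurable]: "u \<in> borel_measurable borel" "v \<in> borel_measurable borel" using add by auto
    have "E t (\<lambda>x. v x + u x) = E t v + E t u" for t
      unfolding E_def by (simp add: nn_integral_add distrib_right)
    moreover have "(\<integral>\<^sup>+p. v p + u p \<partial>Q) \<le> liminf (\<lambda>n. E (r n) v) + liminf (\<lambda>n. E (r n) u)"
      using add by (subst nn_integral_add) (auto intro!: add_mono)
    ultimately show ?case
      using liminf_add_ennreal_le[of "\<lambda>n. E (r n) v" "\<lambda>n. E (r n) u"] by (auto intro: order_trans)
  next
    case (seq U)
    note [measurable] = seq(1)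
    have "(\<integral>\<^sup>+p. (SUP i. U i) p \<partial>Q) = (SUP i. \<integral>\<^sup>+p. U i p \<partial>Q)"
      unfolding SUP_apply using seq by (intro nn_integral_monotone_convergence_SUP) auto
    \<comment> \<open>Monotonicity of \<open>E\<close> bounds each term separately, so no exchange
      of supremum and lower limit occurs.\<close>
    also have "\<dots> \<le> liminf (\<lambda>n. E (r n) (SUP i. U i))"
    proof (rule SUP_least)
      fix i
      have "(\<integral>\<^sup>+p. U i p \<partial>Q) \<le> liminf (\<lambda>n. E (r n) (U i))" by (rule seq)
      also have "\<dots> \<le> liminf (\<lambda>n. E (r n) (SUP i. U i))"
        by (intro Liminf_mono always_eventually allI mono SUP_upper) auto
      finally show "(\<integral>\<^sup>+p. U i p \<partial>Q) \<le> \<dots>" .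
    qed
    finally show ?case .
  qed
  then show ?thesis
    by (simp only: E_def r_def)
qed

section \<open>The bilinear estimate\<close>

lemma ennsqrt_mono: "x \<le> y \<Longrightarrow> ennsqrt x \<le> ennsqrt y"
  by (cases x; cases y) (auto simp: ennsqrt_def top_unique intro!: ennreal_leI)

lemma ennsqrt_mult: "ennsqrt (x * y) = ennsqrt x * ennsqrt y"
  by (cases x; cases y)
    (auto simp: ennsqrt_def real_sqrt_mult ennreal_mult_eq_top_iff ennreal_mult_top ennreal_top_mult enn2real_mult ennreal_mult)

lemma le_ennsqrtI: "x\<^sup>2 \<le> z \<Longrightarrow> x \<le> ennsqrt z"
  by (cases x; cases z)
    (auto simp: ennsqrt_def ennreal_power top_power_ennreal top_unique intro!: ennreal_leI real_le_rsqrt)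

lemma ennsqrt_ennreal: "ennsqrt (ennreal c) = ennreal (sqrt c)"
  by (cases "c \<ge> 0") (auto simp: ennsqrt_def ennreal_neg)

lemma sobolev_neg_norm_mono:
  "(\<And>x. f x \<le> g x) \<Longrightarrow> sobolev_neg_norm s f \<le> sobolev_neg_norm s g"
  unfolding sobolev_neg_norm_def
  by (intro ennsqrt_mono nn_integral_mono power_mono mult_left_mono ennreal_leI) auto

text \<open>The decay of \<open>ft N\<close> is shared out: a factor of order \<open>s1\<close> goes
  to \<open>f\<close>, one of order \<open>s2\<close> to \<open>g\<close>, and Cauchy-Schwarz in
  frequency does the rest. Integrability makes \<open>f\<close> and \<open>g\<close> densities of
  finite measures; the bound on \<open>f\<close> supplies the domination by Lebesgue measure that
  removes the mollification. \<open>K\<close> is independent of \<open>f\<close>, \<open>g\<close>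
  and \<open>B\<close>.\<close>

lemma bilinear_bound_bounded:
  fixes N :: "'a::euclidean_space measure"
  assumes N: "finite_measure N" and sN [measurable_cong]: "sets N = sets borel"
    and "s1 > 0" "s2 > 0"
    and C: "\<And>\<xi>. norm (ft N \<xi>) \<le> C * (1 + norm \<xi>) powr - (s1 + s2)"
  obtains K where "\<And>f g B. f \<in> borel_measurable borel \<Longrightarrow> g \<in> borel_measurable borel \<Longrightarrow>
      (\<And>x. 0 \<le> f x) \<Longrightarrow> (\<And>x. 0 \<le> g x) \<Longrightarrow> (\<And>x. f x \<le> B) \<Longrightarrow>
      (\<integral>\<^sup>+x. ennreal (f x) \<partial>lborel) < \<infinity> \<Longrightarrow> (\<integral>\<^sup>+x. ennreal (g x) \<partial>lborel) < \<infinity> \<Longrightarrow>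
      (\<integral>\<^sup>+x. \<integral>\<^sup>+w. ennreal (f x) * ennreal (g (x - w)) \<partial>N \<partial>lborel)
        \<le> ennreal K * sobolev_neg_norm s1 f * sobolev_neg_norm s2 g"
proof -
  interpret N: finite_measure N by (rule N)
  interpret LN: pair_sigma_finite "lborel :: 'a measure" N ..
  have C0: "C \<ge> 0" using order.trans[OF norm_ge_zero C[of 0]] by simp
  obtain K1 where K1: "K1 > 0" "\<And>M :: 'a measure. finite_measure M \<Longrightarrow> sets M = sets borel \<Longrightarrow>
      (\<integral>\<^sup>+\<xi>. (ennreal (norm (ft M \<xi>) * (1 + norm \<xi>) powr - s1))\<^sup>2 \<partial>lborel)
        \<le> ennreal K1 * (\<integral>\<^sup>+x. (\<integral>\<^sup>+y. bessel_kernel s1 (x - y) \<partial>M)\<^sup>2 \<partial>lborel)"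
    using bessel_potential_norm_ge[OF \<open>s1 > 0\<close>] by blast
  obtain K2 where K2: "K2 > 0" "\<And>M :: 'a measure. finite_measure M \<Longrightarrow> sets M = sets borel \<Longrightarrow>
      (\<integral>\<^sup>+\<xi>. (ennreal (norm (ft M \<xi>) * (1 + norm \<xi>) powr - s2))\<^sup>2 \<partial>lborel)
        \<le> ennreal K2 * (\<integral>\<^sup>+x. (\<integral>\<^sup>+y. bessel_kernel s2 (x - y) \<partial>M)\<^sup>2 \<partial>lborel)"
    using bessel_potential_norm_ge[OF \<open>s2 > 0\<close>] by blast
  \<comment> \<open>\<open>C\<close> comes from the decay of \<open>ft N\<close>; the square roots
    appear because \<open>K1\<close> and \<open>K2\<close> bound squared norms.\<close>
  define K where "K = C * (sqrt K1 * sqrt K2)"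
  show thesis
  proof
    fix f g :: "'a \<Rightarrow> real" and B :: real
    assume [measurable]: "f \<in> borel_measurable borel" "g \<in> borel_measurable borel"
      and f: "\<And>x. 0 \<le> f x" and g: "\<And>x. 0 \<le> g x" and B: "\<And>x. f x \<le> B"
      and ff: "(\<integral>\<^sup>+x. ennreal (f x) \<partial>lborel) < \<infinity>" and gf: "(\<integral>\<^sup>+x. ennreal (g x) \<partial>lborel) < \<infinity>"
    define M1 where "M1 = density lborel (\<lambda>x. ennreal (f x))"
    define M2 where "M2 = density lborel (\<lambda>x. ennreal (g x))"
    have s1 [measurable_cong, simp]: "sets M1 = sets borel" and s2 [measurable_cong, simp]: "sets M2 = sets borel"
      by (simp_all add: M1_def M2_def)
    have M1: "finite_measure M1" and M2: "finite_measure M2"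
      using ff gf by (auto simp: M1_def M2_def emeasure_density intro!: finite_measureI)
    note [measurable] = ft_measurable[OF M1 s1] ft_measurable[OF M2 s2] ft_measurable[OF N sN]
    \<comment> \<open>With this measure the bilinear form is the integral of \<open>g\<close>
      against \<open>Q\<close>.\<close>
    define Q where "Q = diff_measure M1 N"
    have Q: "finite_measure Q" and sQ [measurable_cong, simp]: "sets Q = sets borel"
      using M1 N sN by (auto simp: Q_def finite_measure_diff_measure sets_diff_measure)
    have Q_int: "(\<integral>\<^sup>+p. h p \<partial>Q) = (\<integral>\<^sup>+x. \<integral>\<^sup>+w. ennreal (f x) * h (x - w) \<partial>N \<partial>lborel)"
      if [measurable]: "h \<in> borel_measurable borel" for h
      unfolding Q_def nn_integral_diff_measure[OF M1 s1 N sN that]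
      by (simp add: M1_def nn_integral_density nn_integral_cmult)
    \<comment> \<open>Bounding \<open>f\<close> by \<open>B\<close> and integrating first in
      \<open>x\<close>, translation invariance gives \<open>B\<close> times the Lebesgue measure of
      \<open>A\<close> for each \<open>w\<close>, and integrating over \<open>w\<close> brings in
      the mass of \<open>N\<close>.\<close>
    have Q_le: "emeasure Q A \<le> ennreal (B * measure N (space N)) * emeasure lborel A" if [measurable]: "A \<in> sets borel" for A
    proof -
      have "emeasure Q A = (\<integral>\<^sup>+p. indicator A p \<partial>Q)" by simp
      also have "\<dots> \<le> (\<integral>\<^sup>+x. \<integral>\<^sup>+w. ennreal B * indicator A (x - w) \<partial>N \<partial>lborel)"
        by (subst Q_int) (auto intro!: nn_integral_mono mult_right_mono ennreal_leI B)
      also have "\<dots> = (\<integral>\<^sup>+w. \<integral>\<^sup>+x. ennreal B * indicator A (x - w) \<partial>lborel \<partial>N)"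
        by (rule LN.Fubini'[symmetric]) measurable
      also have "\<dots> = (\<integral>\<^sup>+w. ennreal B * emeasure lborel A \<partial>N)"
      proof (rule nn_integral_cong)
        fix w
        have "(\<integral>\<^sup>+x. ennreal B * indicator A (x - w) \<partial>lborel) = (\<integral>\<^sup>+x. ennreal B * indicator A x \<partial>lborel)"
          by (rule nn_integral_lborel_diff) measurable
        then show "(\<integral>\<^sup>+x. ennreal B * indicator A (x - w) \<partial>lborel) = ennreal B * emeasure lborel A"
          by (simp add: nn_integral_cmult)
      qed
      also have "\<dots> = ennreal (B * measure N (space N)) * emeasure lborel A"
        using order.trans[OF f B] by (simp add: N.emeasure_eq_measure ennreal_mult mult_ac)
      finally show ?thesis .
    qed
    have pot: "(\<integral>\<^sup>+x. (\<integral>\<^sup>+y. bessel_kernel s (x - y) \<partial>density lborel (\<lambda>x. ennreal (h x)))\<^sup>2 \<partial>lborel)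
       = (\<integral>\<^sup>+x. (\<integral>\<^sup>+y. bessel_kernel s (x - y) * ennreal (h y) \<partial>lborel)\<^sup>2 \<partial>lborel)"
      if [measurable]: "h \<in> borel_measurable borel" for h :: "'a \<Rightarrow> real" and s
    proof -
      have "(\<lambda>y. bessel_kernel s (x - y)) \<in> borel_measurable lborel" for x :: 'a
        unfolding bessel_kernel_eq by measurable
      then show ?thesis by (subst nn_integral_density) (auto simp: mult.commute)
    qed
    define a1 where "a1 \<xi> = ennreal (norm (ft M1 \<xi>) * (1 + norm \<xi>) powr - s1)" for \<xi>
    define a2 where "a2 \<xi> = ennreal (norm (ft M2 \<xi>) * (1 + norm \<xi>) powr - s2)" for \<xi>
    have [measurable]: "a1 \<in> borel_measurable borel" "a2 \<in> borel_measurable borel"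
      unfolding a1_def a2_def by measurable
    have a1: "ennsqrt (\<integral>\<^sup>+\<xi>. (a1 \<xi>)\<^sup>2 \<partial>lborel) \<le> ennreal (sqrt K1) * sobolev_neg_norm s1 f"
      using ennsqrt_mono[OF K1(2)[OF M1 s1]] 
      by (simp add: a1_def ennsqrt_mult ennsqrt_ennreal sobolev_neg_norm_def M1_def pot)
    have a2: "ennsqrt (\<integral>\<^sup>+\<xi>. (a2 \<xi>)\<^sup>2 \<partial>lborel) \<le> ennreal (sqrt K2) * sobolev_neg_norm s2 g"
      using ennsqrt_mono[OF K2(2)[OF M2 s2]] 
      by (simp add: a2_def ennsqrt_mult ennsqrt_ennreal sobolev_neg_norm_def M2_def pot)
    have reg: "(\<integral>\<^sup>+p. \<integral>\<^sup>+y. ennreal (g y) * ennreal (gauss t (p - y)) \<partial>lborel \<partial>Q)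
        \<le> ennreal K * sobolev_neg_norm s1 f * sobolev_neg_norm s2 g" if t: "t > 0" for t
    proof -
      \<comment> \<open>The mollified form is a Gaussian average of a further difference measure, so
        the modulus of its transform is the product of those of \<open>M1\<close>, \<open>N\<close>
        and \<open>M2\<close>.\<close>
      have "(\<integral>\<^sup>+p. \<integral>\<^sup>+y. ennreal (g y) * ennreal (gauss t (p - y)) \<partial>lborel \<partial>Q)
         = (\<integral>\<^sup>+z. ennreal (gauss t z) \<partial>diff_measure Q M2)"
        by (subst nn_integral_diff_measure[OF Q sQ M2 s2]) (auto simp: M2_def nn_integral_density)
      also have "\<dots> \<le> (\<integral>\<^sup>+\<xi>. ennreal (norm (ft (diff_measure Q M2) \<xi>)) \<partial>lborel)"
        using t Q M2 by (intro nn_integral_gauss_le_ft) (auto simp: finite_measure_diff_measure sets_diff_measure)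
      also have "\<dots> \<le> (\<integral>\<^sup>+\<xi>. ennreal C * (a1 \<xi> * a2 \<xi>) \<partial>lborel)"
      proof (rule nn_integral_mono)
        fix \<xi> :: 'a
        have "norm (ft (diff_measure Q M2) \<xi>) = norm (ft N \<xi>) * (norm (ft M1 \<xi>) * norm (ft M2 \<xi>))"
          by (simp add: ft_diff_measure[OF Q sQ M2 s2] ft_diff_measure[OF M1 s1 N sN, folded Q_def] norm_mult)
        also have "\<dots> \<le> (C * (1 + norm \<xi>) powr - (s1 + s2)) * (norm (ft M1 \<xi>) * norm (ft M2 \<xi>))"
          by (intro mult_right_mono C) auto
        also have "\<dots> = C * ((norm (ft M1 \<xi>) * (1 + norm \<xi>) powr - s1) * (norm (ft M2 \<xi>) * (1 + norm \<xi>) powr - s2))"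
        proof -
          have "(1 + norm \<xi>) powr - (s1 + s2) = (1 + norm \<xi>) powr - s1 * (1 + norm \<xi>) powr - s2"
            by (simp flip: powr_add)
          then show ?thesis by simp
        qed
        finally show "ennreal (norm (ft (diff_measure Q M2) \<xi>)) \<le> ennreal C * (a1 \<xi> * a2 \<xi>)"
          using C0 by (simp add: a1_def a2_def ennreal_leI flip: ennreal_mult)
      qed
      also have "\<dots> = ennreal C * (\<integral>\<^sup>+\<xi>. a1 \<xi> * a2 \<xi> \<partial>lborel)"
        by (rule nn_integral_cmult) measurable
      also have "(\<integral>\<^sup>+\<xi>. a1 \<xi> * a2 \<xi> \<partial>lborel)
          \<le> ennsqrt ((\<integral>\<^sup>+\<xi>. (a1 \<xi>)\<^sup>2 \<partial>lborel) * (\<integral>\<^sup>+\<xi>. (a2 \<xi>)\<^sup>2 \<partial>lborel))"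
        by (intro le_ennsqrtI Cauchy_Schwarz_nn_integral) measurable
      also have "\<dots> \<le> (ennreal (sqrt K1) * sobolev_neg_norm s1 f) * (ennreal (sqrt K2) * sobolev_neg_norm s2 g)"
        unfolding ennsqrt_mult by (intro mult_mono a1 a2) auto
      also have "ennreal C * \<dots> = ennreal K * sobolev_neg_norm s1 f * sobolev_neg_norm s2 g"
        using C0 K1(1) K2(1) by (simp add: K_def ennreal_mult mult_ac)
      finally show ?thesis by (simp add: mult_left_mono)
    qed
    have "(\<integral>\<^sup>+x. \<integral>\<^sup>+w. ennreal (f x) * ennreal (g (x - w)) \<partial>N \<partial>lborel) = (\<integral>\<^sup>+p. ennreal (g p) \<partial>Q)"
      by (rule Q_int[symmetric]) measurable
    also have "\<dots> \<le> liminf (\<lambda>n. \<integral>\<^sup>+p. \<integral>\<^sup>+y. ennreal (g y) * ennreal (gauss ((1 / real (Suc n))\<^sup>2) (p - y)) \<partial>lborel \<partial>Q)"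
      by (rule gauss_mollify_liminf[OF Q sQ Q_le]) auto
    \<comment> \<open>The bound on the mollified forms is the same for all widths, so it survives
      the lower limit.\<close>
    also have "\<dots> \<le> liminf (\<lambda>n. ennreal K * sobolev_neg_norm s1 f * sobolev_neg_norm s2 g)"
      by (intro Liminf_mono always_eventually allI reg) simp
    finally show "(\<integral>\<^sup>+x. \<integral>\<^sup>+w. ennreal (f x) * ennreal (g (x - w)) \<partial>N \<partial>lborel)
        \<le> ennreal K * sobolev_neg_norm s1 f * sobolev_neg_norm s2 g"
      by (simp add: Liminf_const)
  qed
qed

text \<open>Truncate both functions in height and support. The left side increases to the full form
  by monotone convergence, while positivity of the Bessel kernel keeps the norms of the truncations
  below those of \<open>f\<close> and \<open>g\<close>.\<close>

lemma bilinear_bound: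
  fixes N :: "'a::euclidean_space measure"
  assumes N: "finite_measure N" and sN [measurable_cong]: "sets N = sets borel"
    and "s1 > 0" "s2 > 0"
    and C: "\<And>\<xi>. norm (ft N \<xi>) \<le> C * (1 + norm \<xi>) powr - (s1 + s2)"
  obtains K where "\<And>f g. f \<in> borel_measurable borel \<Longrightarrow> g \<in> borel_measurable borel \<Longrightarrow>
      (\<And>x. 0 \<le> f x) \<Longrightarrow> (\<And>x. 0 \<le> g x) \<Longrightarrow>
      (\<integral>\<^sup>+x. \<integral>\<^sup>+w. ennreal (f x) * ennreal (g (x - w)) \<partial>N \<partial>lborel)
        \<le> ennreal K * sobolev_neg_norm s1 f * sobolev_neg_norm s2 g"
proof -
  obtain K where K: "\<And>f g B. f \<in> borel_measurable borel \<Longrightarrow> g \<in> borel_measurable borel \<Longrightarrow>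
      (\<And>x. 0 \<le> f x) \<Longrightarrow> (\<And>x. 0 \<le> g x) \<Longrightarrow> (\<And>x. f x \<le> B) \<Longrightarrow>
      (\<integral>\<^sup>+x. ennreal (f x) \<partial>lborel) < \<infinity> \<Longrightarrow> (\<integral>\<^sup>+x. ennreal (g x) \<partial>lborel) < \<infinity> \<Longrightarrow>
      (\<integral>\<^sup>+x. \<integral>\<^sup>+w. ennreal (f x) * ennreal (g (x - w)) \<partial>N \<partial>lborel)
        \<le> ennreal K * sobolev_neg_norm s1 f * sobolev_neg_norm s2 g"
    using bilinear_bound_bounded[OF assms] by blast
  interpret N: finite_measure N by (rule N)
  define T where "T n h x = (if norm x \<le> real n then min (h x) (real n) else 0)" for n and h :: "'a \<Rightarrow> real" and x
  show thesis
  proof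
    fix f g :: "'a \<Rightarrow> real"
    assume [measurable]: "f \<in> borel_measurable borel" "g \<in> borel_measurable borel"
      and f: "\<And>x. 0 \<le> f x" and g: "\<And>x. 0 \<le> g x"
    have T_meas [measurable]: "T n h \<in> borel_measurable borel" if [measurable]: "h \<in> borel_measurable borel" for n h
      unfolding T_def by measurable
    have T_nonneg: "0 \<le> T n h x" if "\<And>x. 0 \<le> h x" for n h x
      using that by (auto simp: T_def)
    have T_le: "T n h x \<le> h x" "T n h x \<le> real n" if "\<And>x. 0 \<le> h x" for n h x
      using that by (auto simp: T_def)
    have T_mono: "T m h x \<le> T n h x" if "\<And>x. 0 \<le> h x" "m \<le> n" for m n h x
    proof -
      have "real m \<le> real n" using that by simp
      then show ?thesis using that(1)[of x] unfolding T_def by (auto intro: min.mono)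
    qed
    have T_eq: "T n h x = h x" if "norm x \<le> real n" "h x \<le> real n" for n h x
      using that by (auto simp: T_def)
    have T_fin: "(\<integral>\<^sup>+x. ennreal (T n h x) \<partial>lborel) < \<infinity>" if "\<And>x. 0 \<le> h x" for n h
    proof -
      have "(\<integral>\<^sup>+x. ennreal (T n h x) \<partial>lborel) \<le> (\<integral>\<^sup>+x. ennreal (real n) * indicator (cball 0 (real n)) x \<partial>(lborel :: 'a measure))"
        using that by (intro nn_integral_mono) (auto simp: T_def indicator_def intro!: ennreal_leI)
      also have "\<dots> = ennreal (real n) * emeasure lborel (cball (0::'a) (real n))"
        by (rule nn_integral_cmult_indicator) simp
      also have "\<dots> < \<infinity>"
        using emeasure_bounded_finite[of "cball (0::'a) (real n)"] by (auto simp: ennreal_mult_less_top)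
      finally show ?thesis .
    qed
    have prod_mono: "ennreal (T m f x) * ennreal (T m g y) \<le> ennreal (T n f x) * ennreal (T n g y)"
      if "m \<le> n" for m n x y
      using that f g by (intro mult_mono ennreal_leI T_mono) auto
    \<comment> \<open>The supremum is attained: one \<open>n\<close> exceeding both values and both
      norms leaves both functions untouched at the given points.\<close>
    have sup: "ennreal (f x) * ennreal (g y) = (SUP n. ennreal (T n f x) * ennreal (T n g y))" for x y
    proof (rule antisym)
      obtain n where n: "max (max (f x) (g y)) (max (norm x) (norm y)) \<le> real n"
        using real_arch_simple by blast
      then have "ennreal (f x) * ennreal (g y) = ennreal (T n f x) * ennreal (T n g y)"
        by (simp add: T_eq)
      also have "\<dots> \<le> (SUP n. ennreal (T n f x) * ennreal (T n g y))"
        by (rule SUP_upper) simp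
      finally show "ennreal (f x) * ennreal (g y) \<le> \<dots>" .
      show "(SUP n. ennreal (T n f x) * ennreal (T n g y)) \<le> ennreal (f x) * ennreal (g y)"
        using f g by (intro SUP_least mult_mono ennreal_leI T_le) auto
    qed
    have "(\<integral>\<^sup>+x. \<integral>\<^sup>+w. ennreal (f x) * ennreal (g (x - w)) \<partial>N \<partial>lborel)
      = (\<integral>\<^sup>+x. (SUP n. \<integral>\<^sup>+w. ennreal (T n f x) * ennreal (T n g (x - w)) \<partial>N) \<partial>lborel)"
      unfolding sup
      by (intro nn_integral_cong nn_integral_monotone_convergence_SUP)
        (auto simp: incseq_def le_fun_def intro!: prod_mono)
    also have "\<dots> = (SUP n. \<integral>\<^sup>+x. \<integral>\<^sup>+w. ennreal (T n f x) * ennreal (T n g (x - w)) \<partial>N \<partial>lborel)"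
      by (intro nn_integral_monotone_convergence_SUP)
        (auto simp: incseq_def le_fun_def intro!: prod_mono nn_integral_mono)
    also have "\<dots> \<le> ennreal K * sobolev_neg_norm s1 f * sobolev_neg_norm s2 g"
    proof (rule SUP_least)
      fix n
      have "(\<integral>\<^sup>+x. \<integral>\<^sup>+w. ennreal (T n f x) * ennreal (T n g (x - w)) \<partial>N \<partial>lborel)
        \<le> ennreal K * sobolev_neg_norm s1 (T n f) * sobolev_neg_norm s2 (T n g)"
        by (rule K[of _ _ "real n"]) (auto intro!: T_nonneg T_le T_fin[unfolded infinity_ennreal_def] f g)
      also have "\<dots> \<le> ennreal K * sobolev_neg_norm s1 f * sobolev_neg_norm s2 g"
        by (intro mult_mono sobolev_neg_norm_mono T_le f g) auto
      finally show "(\<integral>\<^sup>+x. \<integral>\<^sup>+w. ennreal (T n f x) * ennreal (T n g (x - w)) \<partial>N \<partial>lborel) \<le> \<dots>" .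
    qed
    finally show "(\<integral>\<^sup>+x. \<integral>\<^sup>+w. ennreal (f x) * ennreal (g (x - w)) \<partial>N \<partial>lborel)
        \<le> ennreal K * sobolev_neg_norm s1 f * sobolev_neg_norm s2 g" .
  qed
qed

section \<open>Bounds for the adjoints\<close>

text \<open>Applying the adjoint identity with \<open>1\<close> in slot \<open>i\<close> and \<open>g = h i\<close> turns the integral of
  \<open>S h\<close> into that of \<open>\<Prod>j. h j (x - v j u)\<close>, where slot \<open>i\<close> is no longer translated.  All three
  cases of the theorem thus concern the law of \<open>v 1 - v 0\<close>.\<close>

lemma adjoint_bounded_of_decay:
  fixes \<mu> :: "(nat \<Rightarrow> 'a::euclidean_space) measure" and k i :: nat
  defines "v j u \<equiv> if j = i then 0 else u j"
  assumes k: "k \<ge> 2" and "i < k"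
    and s\<mu>: "sets \<mu> = sets (PiM {..<k} (\<lambda>_. borel :: 'a measure))"
    and fin: "finite_measure \<mu>"
    and decay: "\<And>\<xi>. norm (\<integral>u. cis (- 2 * pi * (\<xi> \<bullet> (v 1 u - v 0 u))) \<partial>\<mu>) \<le> C * (1 + norm \<xi>) powr - (\<gamma>1 + \<gamma>2)"
    and "\<gamma>1 > 0" "\<gamma>2 > 0"
  shows "adjoint_bounded \<mu> k i \<gamma>1 \<gamma>2"
proof -
  interpret \<mu>: finite_measure \<mu> by (rule fin)
  interpret L\<mu>: pair_sigma_finite "lborel :: 'a measure" \<mu> ..
  have v_meas [measurable]: "v j \<in> borel_measurable \<mu>" if "j < k" for j
  proof -
    have "(\<lambda>u. u j) \<in> borel_measurable (PiM {..<k} (\<lambda>_. borel :: 'a measure))"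
      using that by (intro measurable_component_singleton) auto
    then have "(\<lambda>u. u j) \<in> borel_measurable \<mu>"
      using s\<mu> by (simp cong: measurable_cong_sets)
    then show ?thesis unfolding v_def by (cases "j = i") auto
  qed
  have v01 [measurable]: "v 0 \<in> borel_measurable \<mu>" "v 1 \<in> borel_measurable \<mu>"
    "v (Suc 0) \<in> borel_measurable \<mu>"
    using k by (auto intro!: v_meas)
  define N where "N = distr \<mu> borel (\<lambda>u. v 1 u - v 0 u)"
  have N: "finite_measure N" and sN [measurable_cong, simp]: "sets N = sets borel"
    by (auto simp: N_def intro!: \<mu>.finite_measure_distr)
  interpret N: finite_measure N by (rule N)
  interpret LN: pair_sigma_finite "lborel :: 'a measure" N ..
  have C0: "C \<ge> 0" using order.trans[OF norm_ge_zero decay[of 0]] by simp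
  \<comment> \<open>The Sobolev orders are \<open>\<gamma>1 / 2\<close> and
    \<open>\<gamma>2 / 2\<close>. As \<open>1 + norm \<xi>\<close> is at least 1, the decay passes
    to the smaller exponent, which is their sum.\<close>
  have decay_N: "norm (ft N \<xi>) \<le> C * (1 + norm \<xi>) powr - (\<gamma>1 / 2 + \<gamma>2 / 2)" for \<xi>
  proof -
    have "ft N \<xi> = (\<integral>u. cis (- 2 * pi * (\<xi> \<bullet> (v 1 u - v 0 u))) \<partial>\<mu>)"
      unfolding ft_def N_def by (subst integral_distr) auto
    then have "norm (ft N \<xi>) \<le> C * (1 + norm \<xi>) powr - (\<gamma>1 + \<gamma>2)"
      using decay by simp
    also have "\<dots> \<le> C * (1 + norm \<xi>) powr - (\<gamma>1 / 2 + \<gamma>2 / 2)"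
      using C0 \<open>\<gamma>1 > 0\<close> \<open>\<gamma>2 > 0\<close> by (intro mult_left_mono powr_mono) auto
    finally show ?thesis .
  qed
  obtain K where K: "\<And>f g. f \<in> borel_measurable borel \<Longrightarrow> g \<in> borel_measurable borel \<Longrightarrow>
      (\<And>x. 0 \<le> f x) \<Longrightarrow> (\<And>x. 0 \<le> g x) \<Longrightarrow>
      (\<integral>\<^sup>+x. \<integral>\<^sup>+w. ennreal (f x) * ennreal (g (x - w)) \<partial>N \<partial>lborel)
        \<le> ennreal K * sobolev_neg_norm (\<gamma>1 / 2) f * sobolev_neg_norm (\<gamma>2 / 2) g"
    using bilinear_bound[OF N sN half_gt_zero[OF \<open>\<gamma>1 > 0\<close>] half_gt_zero[OF \<open>\<gamma>2 > 0\<close>] decay_N] by blast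
  show ?thesis
    unfolding adjoint_bounded_def
  proof (intro exI[of _ K] allI impI)
    fix S and h :: "nat \<Rightarrow> 'a \<Rightarrow> real"
    assume S: "is_adjoint \<mu> k i S" and h: "nonneg_fam k h"
    have hm [measurable]: "h j \<in> borel_measurable borel" if "j < k" for j
      using h that by (auto simp: nonneg_fam_def)
    have h0: "0 \<le> h j x" if "j < k" for j x
      using h that by (auto simp: nonneg_fam_def)
    have h01 [measurable]: "h 0 \<in> borel_measurable borel" "h 1 \<in> borel_measurable borel"
      "h (Suc 0) \<in> borel_measurable borel"
      using k by (auto intro!: hm)
    define f where "f = h(i := (\<lambda>_. 1))"
    have f: "nonneg_fam k f" using h by (auto simp: nonneg_fam_def f_def)
    have fh: "f(i := h i) = h" by (simp add: f_def)
    define L where "L = (\<Prod>j\<in>{2..<k}. Linf_norm (h j))"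
    have adj: "(\<integral>\<^sup>+x. T_mu \<mu> k f x * ennreal (h i x) \<partial>lborel) = (\<integral>\<^sup>+y. S (f(i := h i)) y * ennreal (f i y) \<partial>lborel)"
      using S f h \<open>i < k\<close> unfolding is_adjoint_def nonneg_fam_def by blast
    then have "(\<integral>\<^sup>+y. S h y \<partial>lborel) = (\<integral>\<^sup>+x. T_mu \<mu> k f x * ennreal (h i x) \<partial>lborel)"
      unfolding fh by (simp add: f_def)
    also have "\<dots> = (\<integral>\<^sup>+x. \<integral>\<^sup>+u. (\<Prod>j<k. ennreal (h j (x - v j u))) \<partial>\<mu> \<partial>lborel)"
    proof (rule nn_integral_cong)
      fix x
      have meas: "(\<lambda>u. \<Prod>j<k. ennreal (f j (x - u j))) \<in> borel_measurable \<mu>"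
      proof (intro borel_measurable_prod_ennreal)
        fix j assume "j \<in> {..<k}"
        then have j: "j < k" by simp
        have "f j \<in> borel_measurable borel"
          using f j by (auto simp: nonneg_fam_def)
        moreover have "(\<lambda>u. u j) \<in> borel_measurable \<mu>"
          using j s\<mu> by (subst measurable_cong_sets[OF s\<mu> refl]) (auto intro!: measurable_component_singleton)
        ultimately show "(\<lambda>u. ennreal (f j (x - u j))) \<in> borel_measurable \<mu>"
          by measurable
      qed
      have "T_mu \<mu> k f x * ennreal (h i x) = (\<integral>\<^sup>+u. (\<Prod>j<k. ennreal (f j (x - u j))) * ennreal (h i x) \<partial>\<mu>)"
        unfolding T_mu_def by (rule nn_integral_multc[symmetric]) (rule meas)
      also have "\<dots> = (\<integral>\<^sup>+u. (\<Prod>j<k. ennreal (h j (x - v j u))) \<partial>\<mu>)"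
      proof (rule nn_integral_cong)
        fix u
        \<comment> \<open>Away from slot \<open>i\<close> the factors agree. At slot
          \<open>i\<close>, \<open>f i\<close> is 1, and the extra factor \<open>h i x\<close> is
          the untranslated one, since \<open>v i u = 0\<close>.\<close>
        have rem: "(\<Prod>j\<in>{..<k} - {i}. ennreal (f j (x - u j))) = (\<Prod>j\<in>{..<k} - {i}. ennreal (h j (x - v j u)))"
          by (rule prod.cong) (auto simp: f_def v_def)
        have "i \<in> {..<k}" using \<open>i < k\<close> by simp
        then show "(\<Prod>j<k. ennreal (f j (x - u j))) * ennreal (h i x) = (\<Prod>j<k. ennreal (h j (x - v j u)))"
          by (subst (1 2) prod.remove[of _ i]) (auto simp: rem, simp_all add: f_def v_def mult.commute)
      qed
      finally show "T_mu \<mu> k f x * ennreal (h i x) = \<dots>" .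
    qed
    also have "\<dots> = (\<integral>\<^sup>+u. \<integral>\<^sup>+x. (\<Prod>j<k. ennreal (h j (x - v j u))) \<partial>lborel \<partial>\<mu>)"
    proof (rule L\<mu>.Fubini'[symmetric])
      have "(\<lambda>(x, u). ennreal (h j (x - v j u))) \<in> borel_measurable (lborel \<Otimes>\<^sub>M \<mu>)" if "j < k" for j
        using hm[OF that] v_meas[OF that] by measurable
      then show "(\<lambda>(x, u). \<Prod>j<k. ennreal (h j (x - v j u))) \<in> borel_measurable (lborel \<Otimes>\<^sub>M \<mu>)"
        unfolding case_prod_beta by (intro borel_measurable_prod_ennreal) auto
    qed
    also have "\<dots> \<le> (\<integral>\<^sup>+u. \<integral>\<^sup>+x. L * (ennreal (h 0 (x - v 0 u)) * ennreal (h 1 (x - v 1 u))) \<partial>lborel \<partial>\<mu>)"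
    proof (rule nn_integral_mono, rule nn_integral_mono_AE)
      fix u
      \<comment> \<open>Translations preserve null sets, and finitely many null sets can be
        discarded together for each fixed \<open>u\<close>.\<close>
      have "AE x in lborel. \<forall>j\<in>{2..<k}. ennreal (h j (x - v j u)) \<le> Linf_norm (h j)"
      proof (rule AE_finite_allI)
        fix j assume "j \<in> {2..<k}"
        then have [measurable]: "h j \<in> borel_measurable borel" by (intro hm) auto
        have "AE x in lborel. ennreal (h j x) \<le> Linf_norm (h j)"
          unfolding Linf_norm_def by (rule esssup_AE)
        then have "AE x in distr lborel borel ((+) (- v j u)). ennreal (h j x) \<le> Linf_norm (h j)"
          by (simp only: lborel_distr_plus)
        then show "AE x in lborel. ennreal (h j (x - v j u)) \<le> Linf_norm (h j)"
          by (subst (asm) AE_distr_iff) auto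
      qed simp
      then show "AE x in lborel. (\<Prod>j<k. ennreal (h j (x - v j u)))
          \<le> L * (ennreal (h 0 (x - v 0 u)) * ennreal (h 1 (x - v 1 u)))"
      proof eventually_elim
        case (elim x)
        have "{..<k} = {0, 1} \<union> {2..<k}" using k by auto
        then have "(\<Prod>j<k. ennreal (h j (x - v j u)))
            = (\<Prod>j\<in>{0, 1}. ennreal (h j (x - v j u))) * (\<Prod>j\<in>{2..<k}. ennreal (h j (x - v j u)))"
          by (simp only:) (rule prod.union_disjoint, auto)
        also have "\<dots> \<le> (\<Prod>j\<in>{0, 1}. ennreal (h j (x - v j u))) * L"
          unfolding L_def using elim by (intro mult_left_mono prod_mono_ennreal) auto
        finally show ?case by (simp add: mult_ac)
      qed
    qed
    \<comment> \<open>Shifting \<open>x\<close> by \<open>v 0 u\<close> leaves only the difference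
      \<open>v 1 u - v 0 u\<close>, whose law is \<open>N\<close>.\<close>
    also have "\<dots> = (\<integral>\<^sup>+u. L * (\<integral>\<^sup>+x. ennreal (h 0 x) * ennreal (h 1 (x - (v 1 u - v 0 u))) \<partial>lborel) \<partial>\<mu>)"
    proof (rule nn_integral_cong)
      fix u
      have "(\<integral>\<^sup>+x. ennreal (h 0 (x - v 0 u)) * ennreal (h 1 (x - v 1 u)) \<partial>lborel)
          = (\<integral>\<^sup>+x. ennreal (h 0 x) * ennreal (h 1 (x - (v 1 u - v 0 u))) \<partial>lborel)"
        using nn_integral_lborel_diff[of "\<lambda>x. ennreal (h 0 x) * ennreal (h 1 (x - (v 1 u - v 0 u)))" "v 0 u"]
        by simp
      then show "(\<integral>\<^sup>+x. L * (ennreal (h 0 (x - v 0 u)) * ennreal (h 1 (x - v 1 u))) \<partial>lborel)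
          = L * (\<integral>\<^sup>+x. ennreal (h 0 x) * ennreal (h 1 (x - (v 1 u - v 0 u))) \<partial>lborel)"
        by (subst nn_integral_cmult) auto
    qed
    also have "\<dots> = L * (\<integral>\<^sup>+u. \<integral>\<^sup>+x. ennreal (h 0 x) * ennreal (h 1 (x - (v 1 u - v 0 u))) \<partial>lborel \<partial>\<mu>)"
      by (rule nn_integral_cmult) measurable
    also have "(\<integral>\<^sup>+u. \<integral>\<^sup>+x. ennreal (h 0 x) * ennreal (h 1 (x - (v 1 u - v 0 u))) \<partial>lborel \<partial>\<mu>)
        = (\<integral>\<^sup>+w. \<integral>\<^sup>+x. ennreal (h 0 x) * ennreal (h 1 (x - w)) \<partial>lborel \<partial>N)"
      unfolding N_def by (subst nn_integral_distr) auto
    also have "\<dots> = (\<integral>\<^sup>+x. \<integral>\<^sup>+w. ennreal (h 0 x) * ennreal (h 1 (x - w)) \<partial>N \<partial>lborel)"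
      by (rule LN.Fubini') measurable
    also have "L * \<dots> \<le> L * (ennreal K * sobolev_neg_norm (\<gamma>1 / 2) (h 0) * sobolev_neg_norm (\<gamma>2 / 2) (h 1))"
      using k by (intro mult_left_mono K h0) auto
    finally show "(\<integral>\<^sup>+y. S h y \<partial>lborel)
        \<le> ennreal K * sobolev_neg_norm (\<gamma>1 / 2) (h 0) * sobolev_neg_norm (\<gamma>2 / 2) (h 1)
            * (\<Prod>j\<in>{2..<k}. Linf_norm (h j))"
      by (simp add: L_def mult_ac)
  qed
qed

section \<open>The three families of adjoints\<close>

theorem theorem15:
  fixes \<mu> :: "(nat \<Rightarrow> 'a::euclidean_space) measure" and k :: nat and \<gamma> :: real
  assumes "k \<ge> 2"
    and "sets \<mu> = sets (PiM {..<k} (\<lambda>_. borel :: 'a measure))"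
    and "finite_measure \<mu>"
    and "\<gamma> > 0"
  shows
    "((\<exists>C. \<forall>\<xi>::'a. norm (fourier_meas \<mu> k (\<lambda>j. if j = 0 then - \<xi> else if j = 1 then \<xi> else 0))
                   \<le> C * (1 + norm \<xi>) powr (- \<gamma>))
       \<longrightarrow> (\<forall>\<gamma>1 \<gamma>2. \<gamma>1 > 0 \<longrightarrow> \<gamma>2 > 0 \<longrightarrow> \<gamma> = \<gamma>1 + \<gamma>2 \<longrightarrow>
              (\<forall>i\<in>{3..k}. adjoint_bounded \<mu> k (i - 1) \<gamma>1 \<gamma>2)))
     \<and> ((\<exists>C. \<forall>\<xi>::'a. norm (fourier_meas \<mu> k (\<lambda>j. if j = 1 then \<xi> else 0))
                   \<le> C * (1 + norm \<xi>) powr (- \<gamma>))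
       \<longrightarrow> (\<forall>\<gamma>1 \<gamma>2. \<gamma>1 > 0 \<longrightarrow> \<gamma>2 > 0 \<longrightarrow> \<gamma> = \<gamma>1 + \<gamma>2 \<longrightarrow>
              adjoint_bounded \<mu> k 0 \<gamma>1 \<gamma>2))
     \<and> ((\<exists>C. \<forall>\<xi>::'a. norm (fourier_meas \<mu> k (\<lambda>j. if j = 0 then \<xi> else 0))
                   \<le> C * (1 + norm \<xi>) powr (- \<gamma>))
       \<longrightarrow> (\<forall>\<gamma>1 \<gamma>2. \<gamma>1 > 0 \<longrightarrow> \<gamma>2 > 0 \<longrightarrow> \<gamma> = \<gamma>1 + \<gamma>2 \<longrightarrow>
              adjoint_bounded \<mu> k 1 \<gamma>1 \<gamma>2))"
proof -
  have k: "{..<k} = {0, 1} \<union> {2..<k}" using assms(1) by auto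
  \<comment> \<open>In each hypothesis the frequency vector is supported on the first two
    blocks.\<close>
  have split: "(\<Sum>j<k. \<eta> j \<bullet> u j) = \<eta> 0 \<bullet> u 0 + \<eta> 1 \<bullet> u 1" if "\<And>j. j \<ge> 2 \<Longrightarrow> \<eta> j = 0"
    for \<eta> u :: "nat \<Rightarrow> 'a"
  proof -
    have "(\<Sum>j<k. \<eta> j \<bullet> u j) = (\<Sum>j\<in>{0, 1}. \<eta> j \<bullet> u j)"
      unfolding k by (rule sum.mono_neutral_right) (auto simp: that)
    then show ?thesis by simp
  qed
  note bounded = adjoint_bounded_of_decay[OF assms(1) _ assms(2,3)]
  show ?thesis
  proof (intro conjI impI allI ballI; elim exE)
    fix \<gamma>1 \<gamma>2 C :: real and i
    assume "\<gamma>1 > 0" "\<gamma>2 > 0" "\<gamma> = \<gamma>1 + \<gamma>2" and i: "i \<in> {3..k}"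
      and C: "\<forall>\<xi>::'a. norm (fourier_meas \<mu> k (\<lambda>j. if j = 0 then - \<xi> else if j = 1 then \<xi> else 0))
                   \<le> C * (1 + norm \<xi>) powr (- \<gamma>)"
    \<comment> \<open>The index shifts by one: \<open>i \<ge> 3\<close> becomes slot
      \<open>i - 1 \<ge> 2\<close>, so blocks 0 and 1 both keep their translations and
      \<open>v 1 - v 0\<close> is \<open>u 1 - u 0\<close>.\<close>
    moreover have "Suc 0 \<noteq> i - Suc 0" using i by auto
    ultimately show "adjoint_bounded \<mu> k (i - 1) \<gamma>1 \<gamma>2"
      using C by (intro bounded[where C=C]) (auto simp: fourier_meas_def split inner_diff_right)
  next
    fix \<gamma>1 \<gamma>2 C :: real
    assume "\<gamma>1 > 0" "\<gamma>2 > 0" "\<gamma> = \<gamma>1 + \<gamma>2"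
      and C: "\<forall>\<xi>::'a. norm (fourier_meas \<mu> k (\<lambda>j. if j = 1 then \<xi> else 0))
                   \<le> C * (1 + norm \<xi>) powr (- \<gamma>)"
    \<comment> \<open>Slot 0 is untranslated, so \<open>v 1 - v 0\<close> is
      \<open>u 1\<close>.\<close>
    then show "adjoint_bounded \<mu> k 0 \<gamma>1 \<gamma>2"
      using assms(1) by (intro bounded[where C=C]) (auto simp: fourier_meas_def split)
  next
    fix \<gamma>1 \<gamma>2 C :: real
    assume \<gamma>: "\<gamma>1 > 0" "\<gamma>2 > 0" "\<gamma> = \<gamma>1 + \<gamma>2"
      and C: "\<forall>\<xi>::'a. norm (fourier_meas \<mu> k (\<lambda>j. if j = 0 then \<xi> else 0))
                   \<le> C * (1 + norm \<xi>) powr (- \<gamma>)"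
    \<comment> \<open>Here slot 1 is untranslated and \<open>v 1 - v 0\<close> is
      \<open>- u 0\<close>, so the hypothesis is used at \<open>- \<xi>\<close>, which has the same
      norm.\<close>
    have "norm (fourier_meas \<mu> k (\<lambda>j. if j = 0 then - \<xi> else 0)) \<le> C * (1 + norm \<xi>) powr (- \<gamma>)" for \<xi> :: 'a
      using C[rule_format, of "- \<xi>"] by simp
    then show "adjoint_bounded \<mu> k 1 \<gamma>1 \<gamma>2"
      using assms(1) \<gamma> by (intro bounded[where C=C]) (auto simp: fourier_meas_def split)
  qed
qed

end
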